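(* Let $\mathcal{A}$ be a semiprime, complex, unital Banach algebra with $\mathrm{soc}(\mathcal{A})\neq\{0\}$, let $x\in\mathcal{A}$ and $\lambda_0\in\mathbb{C}$, and suppose that $x-\lambda_0$ is B-Fredholm. Then the following assertions are equivalent: (1) $x$ has right SVEP at $\lambda_0$; (2) $p_r(x-\lambda_0)<\infty$; (3) $q_l(x-\lambda_0)<\infty$; (4) $\sigma_r(x)$ does not cluster at $\lambda_0$; (5) $\lambda_0$ is not an interior point of $\sigma_r(x)$; (6) $H_r(x-\lambda_0)=L((x-\lambda_0)^p)$ for some $p\in\mathbb{N}$; (7) $H_r(x-\lambda_0)$ is closed; (8) $H_r(x-\lambda_0)\cap K_r(x-\lambda_0)=\{0\}$; (9) $H_r(x-\lambda_0)\cap K_r(x-\lambda_0)$ is closed; (10) $\bigcup_{n=1}^{\infty}L((x-\lambda_0)^n)\cap\bigcap_{n=1}^{\infty}\mathcal{A}(x-\lambda_0)^n=\{0\}$. In this case, if $p:=p_r(x-\lambda_0)$, then $$H_r(x-\lambda_0)=\bigcup_{n=1}^{\infty}L((x-\lambda_0)^n)=L((x-\lambda_0)^p).$$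
   Context: An algebra is semiprime if $\{0\}$ is its only two-sided ideal $J$ with $J^2=\{0\}$. $\mathrm{soc}(\mathcal{A})$ is the sum of all minimal right ideals of $\mathcal{A}$ (equal to the sum of all minimal left ideals), or $\{0\}$ if there are none. An element $a$ of a ring is Drazin invertible if there are $b$ in the ring and $k\in\mathbb{N}$ with $bab=b$, $ab=ba$, $a^kba=a^k$. An element $a\in\mathcal{A}$ is B-Fredholm if its image in $\mathcal{A}/\mathrm{soc}(\mathcal{A})$ is Drazin invertible. $x-\lambda$ means $x-\lambda 1$. $L(x)=\{a\in\mathcal{A}:ax=0\}$. $x$ has right SVEP (right single-valued extension property) at $\lambda\in\mathbb{C}$ if for every connected open neighbourhood $U$ of $\lambda$ the only holomorphic $f:U\to\mathcal{A}$ with $f(\mu)(\mu-x)=0$ for all $\mu\in U$ is $f\equiv0$. $L_x(a)=xa$ and $R_x(a)=ax$ are the multiplication operators on $\mathcal{A}$. For a bounded linear operator $T$ on a Banach space, the ascent is $p(T)=\inf\{n\ge 0:\ker T^n=\ker T^{n+1}\}$ and the descent is $q(T)=\inf\{n\geq 0:\mathrm{ran}\,T^n=\mathrm{ran}\,T^{n+1}\}$ (with $\inf\emptyset=\infty$). $p_r(x)=p(R_x)$ and $q_l(x)=q(L_x)$. $\sigma_r(x)=\{\lambda\in\mathbb{C}:x-\lambda\text{ is not right invertible}\}$ is the right spectrum. A set clusters at $\lambda_0$ if $\lambda_0$ is an accumulation point of it. $H_r(x)=\{a\in\mathcal{A}:\lim_{n\to\infty}\|ax^n\|^{1/n}=0\}$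 (right quasinilpotent part). $K_r(x)$ (right analytical core) is the set of $a\in\mathcal{A}$ for which there exist a sequence $(a_n)_{n\ge1}$ in $\mathcal{A}$ and $\delta>0$ with $a_1x=a$, $a_{n+1}x=a_n$ and $\|a_n\|\le\delta^n\|a\|$ for all $n\ge 1$. *)

theory Defs
  imports
    "HOL-Analysis.Analysis"
    "HOL-Algebra.QuotRing"
    "HOL-Algebra.Ideal_Product"
    "HOL-Algebra.Algebraic_Closure_Type"
begin

text \<open>
  Complex unital Banach algebras. The real structure needed by the analysis library is the
  restriction of the complex one. No normalisation of the norm of the unit is assumed.
\<close>

class complex_unital_banach_algebra = real_normed_algebra + ring_1 + banach +
  fixes scaleC :: "complex \<Rightarrow> 'a \<Rightarrow> 'a"  (infixr "*\<^sub>C" 75)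
  assumes scaleC_add_right: "c *\<^sub>C (a + b) = c *\<^sub>C a + c *\<^sub>C b"
    and scaleC_add_left: "(c + d) *\<^sub>C a = c *\<^sub>C a + d *\<^sub>C a"
    and scaleC_scaleC: "c *\<^sub>C (d *\<^sub>C a) = (c * d) *\<^sub>C a"
    and scaleC_of_real: "complex_of_real r *\<^sub>C a = r *\<^sub>R a"
    and mult_scaleC_left: "(c *\<^sub>C a) * b = c *\<^sub>C (a * b)"
    and mult_scaleC_right: "a * (c *\<^sub>C b) = c *\<^sub>C (a * b)"
    and norm_scaleC: "norm (c *\<^sub>C a) = cmod c * norm a"

subsection \<open>Semiprimeness, socle, B-Fredholm elements\<close>

text \<open>
  The constant \<^const>\<open>ring_of_type_algebra\<close> is the algebra as a ring object, so that ideals, their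
  products and quotient rings are those of the algebra library. In a unital algebra every (right
  or two-sided) ring ideal is closed under complex scalars, since \<open>c *\<^sub>C a = a * (c *\<^sub>C 1)\<close>.
\<close>

definition semiprime :: "'a::ring_1 itself \<Rightarrow> bool" where
  "semiprime _ \<longleftrightarrow>
    (\<forall>J :: 'a set. ideal J ring_of_type_algebra \<longrightarrow>
       ideal_prod ring_of_type_algebra J J = {0} \<longrightarrow> J = {0})"

definition right_ideal :: "'a::ring_1 set \<Rightarrow> bool" where
  "right_ideal J \<longleftrightarrow> 0 \<in> J \<and> (\<forall>a\<in>J. \<forall>b\<in>J. a + b \<in> J) \<and> (\<forall>a\<in>J. \<forall>b. a * b \<in> J)"

definition minimal_right_ideal :: "'a::ring_1 set \<Rightarrow> bool" where
  "minimal_right_ideal J \<longleftrightarrow> right_ideal J \<and> J \<noteq> {0} \<and>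
    (\<forall>I. right_ideal I \<and> I \<subseteq> J \<longrightarrow> I = {0} \<or> I = J)"

definition soc :: "'a::ring_1 set" where
  "soc = {\<Sum>J\<in>F. f J | F f. finite F \<and> (\<forall>J\<in>F. minimal_right_ideal J \<and> f J \<in> J)}"

definition drazin_invertible :: "('r, 'm) ring_scheme \<Rightarrow> 'r \<Rightarrow> bool" where
  "drazin_invertible R a \<longleftrightarrow>
    (\<exists>b\<in>carrier R. \<exists>k::nat.
       b \<otimes>\<^bsub>R\<^esub> a \<otimes>\<^bsub>R\<^esub> b = b \<and>
       a \<otimes>\<^bsub>R\<^esub> b = b \<otimes>\<^bsub>R\<^esub> a \<and>
       a [^]\<^bsub>R\<^esub> k \<otimes>\<^bsub>R\<^esub> b \<otimes>\<^bsub>R\<^esub> a = a [^]\<^bsub>R\<^esub> k)"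

definition B_Fredholm :: "'a::ring_1 \<Rightarrow> bool" where
  "B_Fredholm a \<longleftrightarrow>
    drazin_invertible (ring_of_type_algebra Quot soc) (soc +>\<^bsub>ring_of_type_algebra\<^esub> a)"

subsection \<open>Right SVEP and right spectrum\<close>

text \<open>
  Holomorphy of algebra-valued functions: the real derivative at each point exists and is
  complex linear.
\<close>

definition holomorphic_valued_on ::
    "(complex \<Rightarrow> 'a::complex_unital_banach_algebra) \<Rightarrow> complex set \<Rightarrow> bool" where
  "holomorphic_valued_on f U \<longleftrightarrow>
    (\<forall>\<mu>\<in>U. \<exists>d. (f has_derivative (\<lambda>h. h *\<^sub>C d)) (at \<mu> within U))"

definition right_SVEP :: "'a::complex_unital_banach_algebra \<Rightarrow> complex \<Rightarrow> bool" where
  "right_SVEP x l \<longleftrightarrow>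
    (\<forall>U. open U \<and> connected U \<and> l \<in> U \<longrightarrow>
      (\<forall>f. holomorphic_valued_on f U \<and> (\<forall>\<mu>\<in>U. f \<mu> * (\<mu> *\<^sub>C 1 - x) = 0) \<longrightarrow>
        (\<forall>\<mu>\<in>U. f \<mu> = 0)))"

definition right_invertible :: "'a::ring_1 \<Rightarrow> bool" where
  "right_invertible a \<longleftrightarrow> (\<exists>b. a * b = 1)"

definition right_spectrum :: "'a::complex_unital_banach_algebra \<Rightarrow> complex set" where
  "right_spectrum x = {l. \<not> right_invertible (x - l *\<^sub>C 1)}"

subsection \<open>Ascent and descent\<close>

text \<open>With values in \<^typ>\<open>enat\<close>, the infimum of the empty set is \<open>\<infinity>\<close>.\<close>

definition ascent :: "('v::zero \<Rightarrow> 'v) \<Rightarrow> enat" where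
  "ascent T = Inf {enat n | n. {v. (T ^^ n) v = 0} = {v. (T ^^ Suc n) v = 0}}"

definition descent :: "('v \<Rightarrow> 'v) \<Rightarrow> enat" where
  "descent T = Inf {enat n | n. range (T ^^ n) = range (T ^^ Suc n)}"

definition right_ascent :: "'a::ring_1 \<Rightarrow> enat" where
  "right_ascent x = ascent (\<lambda>a. a * x)"

definition left_descent :: "'a::ring_1 \<Rightarrow> enat" where
  "left_descent x = descent (\<lambda>a. x * a)"

subsection \<open>Annihilators, right quasinilpotent part, right analytical core\<close>

definition left_annihilator :: "'a::ring_1 \<Rightarrow> 'a set" where
  "left_annihilator x = {a. a * x = 0}"

definition right_quasinilpotent_part :: "'a::complex_unital_banach_algebra \<Rightarrow> 'a set" where
  "right_quasinilpotent_part x = {a. (\<lambda>n. root n (norm (a * x ^ n))) \<longlonglongrightarrow> 0}"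

text \<open>The value \<open>s 0\<close> is irrelevant: sequences are indexed from 1.\<close>

definition right_analytical_core :: "'a::complex_unital_banach_algebra \<Rightarrow> 'a set" where
  "right_analytical_core x =
    {a. \<exists>(s :: nat \<Rightarrow> 'a) \<delta>. \<delta> > 0 \<and> s 1 * x = a \<and>
          (\<forall>n\<ge>1. s (Suc n) * x = s n \<and> norm (s n) \<le> \<delta> ^ n * norm a)}"

end

(*
  Write y = x - l0. In a semiprime ring every element of the socle is von Neumann regular, and left
  ideals inside A s with s in the socle satisfy the descending chain condition. If y is Drazin
  invertible modulo the socle, it follows that y^n is regular for large n and that the left ideals
  L(y) \<inter> A y^n stabilise. Hence right multiplication by y maps the hyperrange M = \<Inter>n. A y^n onto
  itself, with a right inverse given by right multiplication by an element s, so that no open mapping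
  theorem is needed.

  All conditions are equivalent to L(y) \<inter> M = {0}. If this holds, regularity gives
  y^n = y^(n+1) c for some n and c. So y^n = y^(n+j) c^j for all j, which forces H_r(y) = L(y^n), and
  y - l is right invertible for small l \<noteq> 0. Otherwise a nonzero v in L(y) \<inter> M yields
  holomorphic eigenvectors f(l) = \<Sum>n. l^n v s^n with f(l) y = l f(l): they refute the right SVEP, and
  they are limits of elements of H_r(y) \<inter> K_r(y) that are not in H_r(y) themselves for l \<noteq> 0.
  That (5) implies (1) is the identity theorem, reduced to complex-valued functions by Hahn-Banach.
*)

theory Submission
  imports Defs "HOL-Complex_Analysis.Conformal_Mappings"
begin

section \<open>The socle of a semiprime ring\<close>

lemma ring_of_type_algebra_simps [simp]:
  "carrier ring_of_type_algebra = UNIV"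
  "\<zero>\<^bsub>ring_of_type_algebra\<^esub> = 0"
  "\<one>\<^bsub>ring_of_type_algebra\<^esub> = 1"
  "a \<oplus>\<^bsub>ring_of_type_algebra\<^esub> b = a + b"
  "a \<otimes>\<^bsub>ring_of_type_algebra\<^esub> b = a * b"
  by (simp_all add: ring_of_type_algebra_def)

lemma ring_ring_of_type_algebra: "ring (ring_of_type_algebra :: 'a::ring_1 ring)"
proof -
  have "\<exists>y. x + y = 0" for x :: 'a
    using add.right_inverse by blast
  then show ?thesis
    unfolding ring_of_type_algebra_def using add.right_inverse
    by unfold_locales (auto simp: algebra_simps Units_def)
qed

lemma pow_ring_of_type_algebra [simp]:
  fixes a :: "'a::ring_1" and n :: nat
  shows "a [^]\<^bsub>ring_of_type_algebra\<^esub> n = a ^ n"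
proof -
  interpret ring "ring_of_type_algebra :: 'a ring"
    by (rule ring_ring_of_type_algebra)
  show ?thesis
    by (induction n) (simp_all add: power_commutes)
qed

lemma ideal_ring_of_type_algebraI:
  fixes J :: "'a::ring_1 set"
  assumes "0 \<in> J" "\<And>a b. a \<in> J \<Longrightarrow> b \<in> J \<Longrightarrow> a + b \<in> J"
    and "\<And>a r. a \<in> J \<Longrightarrow> r * a \<in> J" "\<And>a r. a \<in> J \<Longrightarrow> a * r \<in> J"
  shows "ideal J ring_of_type_algebra"
proof -
  interpret R: ring "ring_of_type_algebra :: 'a ring"
    by (rule ring_ring_of_type_algebra)
  have inv: "inv\<^bsub>add_monoid (ring_of_type_algebra :: 'a ring)\<^esub> a = - a" for a :: 'a
  proof -
    have "\<ominus>\<^bsub>ring_of_type_algebra\<^esub> a = - a"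
      by (rule R.minus_equality) simp_all
    then show ?thesis
      by (simp add: a_inv_def)
  qed
  have neg: "- a \<in> J" if "a \<in> J" for a
    using assms(3)[OF that, of "- 1"] by simp
  show ?thesis
  proof (rule idealI)
    show "ring (ring_of_type_algebra :: 'a ring)"
      by (rule R.ring_axioms)
    show "subgroup J (add_monoid ring_of_type_algebra)"
    proof (rule subgroup.intro)
      show "inv\<^bsub>add_monoid ring_of_type_algebra\<^esub> a \<in> J" if "a \<in> J" for a
        unfolding inv by (rule neg[OF that])
    qed (use assms in auto)
  qed (use assms in auto)
qed

text \<open>The annihilator ideal \<open>J\<close> replaces the ideal generated by \<open>x\<close>,
  so no finite sums are needed. It contains \<open>x\<close>, and its square is zero because
  \<open>J\<close> lies in \<open>I\<close> and annihilates \<open>I\<close> from the left.\<close>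

lemma semiprimeD:
  fixes x :: "'a::ring_1"
  assumes sp: "semiprime TYPE('a)" and x: "\<And>r. x * r * x = 0"
  shows "x = 0"
proof -
  define I where "I = {z. \<forall>r. x * r * z = 0}"
  define J where "J = {w\<in>I. \<forall>z\<in>I. w * z = 0}"
  have I_left: "r * z \<in> I" if "z \<in> I" for r z
  proof -
    have "x * s * (r * z) = x * (s * r) * z" for s
      by (simp add: mult.assoc)
    then show ?thesis
      using that by (simp add: I_def)
  qed
  have I_right: "z * r \<in> I" if "z \<in> I" for r z
  proof -
    have "x * s * (z * r) = x * s * z * r" for s
      by (simp add: mult.assoc)
    then show ?thesis
      using that by (simp add: I_def)
  qed
  have J: "ideal J ring_of_type_algebra"
  proof (rule ideal_ring_of_type_algebraI)
    show "0 \<in> J" by (simp add: J_def I_def)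
    show "a + b \<in> J" if "a \<in> J" "b \<in> J" for a b
      using that by (auto simp: J_def I_def algebra_simps)
    show "r * a \<in> J" "a * r \<in> J" if "a \<in> J" for a r
      using that I_left I_right by (auto simp: J_def mult.assoc)
  qed
  have "z = 0" if "z \<in> ideal_prod ring_of_type_algebra J J" for z
    using that by induction (auto simp: J_def)
  moreover have "0 \<in> ideal_prod ring_of_type_algebra J J"
    using ideal_prod.prod[of 0 J 0 J ring_of_type_algebra] by (simp add: J_def I_def)
  ultimately have "J = {0}"
    using sp J unfolding semiprime_def by blast
  moreover have "x \<in> J"
    using x by (auto simp: J_def I_def dest: spec[of _ 1])
  ultimately show ?thesis by simp
qed

section \<open>Simple elements and the socle as the set of their sums\<close>

text \<open>Says without ideals that \<open>j\<close> is 0 or \<open>j A\<close> is a minimal right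
  ideal. Admitting 0 makes the property stable under multiplication from both sides.\<close>

definition right_simple :: "'a::ring_1 \<Rightarrow> bool" where
  "right_simple j \<longleftrightarrow> (\<forall>t. j * t \<noteq> 0 \<longrightarrow> (\<exists>u. j * t * u = j))"

definition left_simple :: "'a::ring_1 \<Rightarrow> bool" where
  "left_simple j \<longleftrightarrow> (\<forall>t. t * j \<noteq> 0 \<longrightarrow> (\<exists>u. u * t * j = j))"

lemma right_simple_mult_left: "right_simple j \<Longrightarrow> right_simple (r * j)"
  unfolding right_simple_def by (metis mult.assoc mult_zero_right)

lemma right_simple_mult_right: "right_simple j \<Longrightarrow> right_simple (j * r)"
  unfolding right_simple_def by (metis mult.assoc)

lemma right_ideal_range: "right_ideal (range ((*) a))"
proof -
  have "a * b + a * c \<in> range ((*) a)" for b c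
    by (metis distrib_left rangeI)
  moreover have "0 \<in> range ((*) a)"
    by (metis mult_zero_right rangeI)
  ultimately show ?thesis
    by (auto simp: right_ideal_def mult.assoc)
qed

lemma minimal_right_ideal_range:
  assumes "right_simple j" "j \<noteq> 0"
  shows "minimal_right_ideal (range ((*) j))"
  unfolding minimal_right_ideal_def
proof (intro conjI allI impI right_ideal_range)
  show "range ((*) j) \<noteq> {0}"
    using assms(2) by (metis mult.right_neutral rangeI singletonD)
  fix I assume I: "right_ideal I \<and> I \<subseteq> range ((*) j)"
  show "I = {0} \<or> I = range ((*) j)"
  proof (cases "I = {0}")
    case False
    then obtain t where t: "j * t \<in> I" "j * t \<noteq> 0"
      using I unfolding right_ideal_def by blast
    then obtain u where "j * t * u = j"
      using assms unfolding right_simple_def by blast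
    then have "j \<in> I"
      using I t unfolding right_ideal_def by metis
    then show ?thesis
      using I unfolding right_ideal_def by blast
  qed simp
qed

lemma right_simple_minimal_right_ideal:
  assumes J: "minimal_right_ideal J" and j: "j \<in> J"
  shows "right_simple j"
  unfolding right_simple_def
proof (intro allI impI)
  fix t assume t: "j * t \<noteq> 0"
  have "range ((*) (j * t)) \<subseteq> J"
    using J j by (auto simp: minimal_right_ideal_def right_ideal_def)
  moreover have "range ((*) (j * t)) \<noteq> {0}"
    using t by (metis mult.right_neutral rangeI singletonD)
  ultimately have "range ((*) (j * t)) = J"
    using J right_ideal_range[of "j * t"] unfolding minimal_right_ideal_def by blast
  then show "\<exists>u. j * t * u = j"
    using j by (metis imageE)
qed

lemma soc_add:
  assumes "a \<in> soc" "b \<in> soc"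
  shows "a + b \<in> soc"
proof -
  from assms obtain F f G g where
    F: "a = (\<Sum>J\<in>F. f J)" "finite F" "\<forall>J\<in>F. minimal_right_ideal J \<and> f J \<in> J" and
    G: "b = (\<Sum>J\<in>G. g J)" "finite G" "\<forall>J\<in>G. minimal_right_ideal J \<and> g J \<in> J"
    unfolding soc_def by auto
  \<comment> \<open>The two families may use the same minimal ideal, and \<open>soc\<close> allows
    one summand per ideal, so the summands are merged ideal by ideal.\<close>
  define h where "h J = (if J \<in> F then f J else 0) + (if J \<in> G then g J else 0)" for J
  have "(\<Sum>J\<in>F \<union> G. h J) = (\<Sum>J\<in>F \<union> G. if J \<in> F then f J else 0) + (\<Sum>J\<in>F \<union> G. if J \<in> G then g J else 0)"
    by (simp add: h_def sum.distrib)
  also have "\<dots> = a + b"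
    using F G by (simp add: sum.If_cases Int_absorb1 Int_absorb2 Un_Int_distrib2)
  finally have "a + b = (\<Sum>J\<in>F \<union> G. h J)" ..
  moreover have "h J \<in> J" if "J \<in> F \<union> G" for J
  proof -
    have "right_ideal J"
      using that F(3) G(3) by (auto simp: minimal_right_ideal_def)
    then show ?thesis
      using that F(3) G(3) by (auto simp: h_def right_ideal_def)
  qed
  ultimately show ?thesis
    using F G unfolding soc_def by blast
qed

lemma zero_in_soc: "0 \<in> soc"
  unfolding soc_def by (rule CollectI) (metis sum.empty empty_iff finite.emptyI)

lemma right_simple_in_soc:
  assumes "right_simple j"
  shows "j \<in> soc"
proof (cases "j = 0")
  case False
  have "j \<in> range ((*) j)"
    by (metis mult.right_neutral rangeI)
  then have "j = (\<Sum>J\<in>{range ((*) j)}. j) \<and> finite {range ((*) j)} \<and>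
      (\<forall>J\<in>{range ((*) j)}. minimal_right_ideal J \<and> j \<in> J)"
    using minimal_right_ideal_range[OF assms False] by simp
  then show ?thesis
    unfolding soc_def by (intro CollectI exI[of _ "{range ((*) j)}"] exI[of _ "\<lambda>_. j"])
qed (simp add: zero_in_soc)

text \<open>Unlike the defining families, a list may hold several elements of one minimal ideal.
  Multiplying every entry by a ring element therefore keeps the form, and induction over the
  summands becomes possible.\<close>

lemma soc_eq: "soc = {sum_list js | js. \<forall>j\<in>set js. right_simple j}"
proof (intro equalityI subsetI)
  fix a :: 'a assume "a \<in> soc"
  then obtain F f where F: "a = (\<Sum>J\<in>F. f J)" "finite F"
    "\<forall>J\<in>F. minimal_right_ideal J \<and> f J \<in> J"
    unfolding soc_def by blast
  obtain Js where Js: "set Js = F" "distinct Js"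
    using F(2) finite_distinct_list by blast
  have "a = sum_list (map f Js)"
    using Js F(1) by (simp add: sum_list_distinct_conv_sum_set)
  moreover have "\<forall>j\<in>set (map f Js). right_simple j"
    using Js F(3) right_simple_minimal_right_ideal by auto
  ultimately show "a \<in> {sum_list js | js. \<forall>j\<in>set js. right_simple j}"
    by blast
next
  fix a :: 'a assume "a \<in> {sum_list js | js. \<forall>j\<in>set js. right_simple j}"
  then obtain js where "a = sum_list js" "\<forall>j\<in>set js. right_simple j"
    by blast
  moreover have "sum_list js \<in> soc" if "\<forall>j\<in>set js. right_simple j" for js :: "'a list"
    using that by (induction js) (auto intro: zero_in_soc soc_add right_simple_in_soc)
  ultimately show "a \<in> soc" by blast
qed

lemma soc_mult_left:
  assumes "a \<in> soc"
  shows "r * a \<in> soc"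
proof -
  obtain js where js: "a = sum_list js" "\<forall>j\<in>set js. right_simple j"
    using assms unfolding soc_eq by blast
  then have "r * a = sum_list (map ((*) r) js)"
    by (simp add: sum_list_const_mult)
  then show ?thesis
    using js right_simple_mult_left unfolding soc_eq by fastforce
qed

lemma soc_mult_right:
  assumes "a \<in> soc"
  shows "a * r \<in> soc"
proof -
  obtain js where js: "a = sum_list js" "\<forall>j\<in>set js. right_simple j"
    using assms unfolding soc_eq by blast
  then have "a * r = sum_list (map (\<lambda>j. j * r) js)"
    by (simp add: sum_list_mult_const)
  then show ?thesis
    using js right_simple_mult_right unfolding soc_eq by fastforce
qed

lemma soc_diff: "a \<in> soc \<Longrightarrow> b \<in> soc \<Longrightarrow> a - b \<in> soc"
  using soc_add[of a "- 1 * b"] soc_mult_left[of b "- 1"] by simp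

lemma ideal_soc: "ideal (soc :: 'a::ring_1 set) ring_of_type_algebra"
  by (rule ideal_ring_of_type_algebraI)
    (simp_all add: zero_in_soc soc_add soc_mult_left soc_mult_right)

section \<open>Von Neumann regularity in the socle\<close>

text \<open>Brauer's lemma. Semiprimeness gives \<open>r\<close> with
  \<open>j * r * j \<noteq> 0\<close>, simplicity turns this into an idempotent
  \<open>g = j * (u * r)\<close> with \<open>g A = j A\<close>, and an idempotent fixes from the
  left every element of the right ideal that it generates.\<close>

lemma right_simple_regular:
  fixes j :: "'a::ring_1"
  assumes sp: "semiprime TYPE('a)" and j: "right_simple j"
  shows "\<exists>t. j * t * j = j"
proof (cases "j = 0")
  case False
  then obtain r where r: "j * r * j \<noteq> 0"
    using semiprimeD[OF sp] by blast
  then obtain u where u: "j * (r * j) * u = j"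
    using j unfolding right_simple_def by (metis mult.assoc)
  define g where "g = j * (u * r)"
  have jrg: "j * r * g = j * r"
    using u by (simp add: g_def flip: mult.assoc)
  \<comment> \<open>\<open>j * r\<close> annihilates \<open>g * g - g\<close> from the left. Were
    this element of \<open>j A\<close> nonzero, it would generate \<open>j\<close>, and
    \<open>j * r\<close> would annihilate \<open>j\<close>.\<close>
  have "g * g = g"
  proof (rule ccontr)
    assume "g * g \<noteq> g"
    then have "j * (u * r * g - u * r) \<noteq> 0"
      by (simp add: g_def algebra_simps)
    then obtain w where w: "j * (u * r * g - u * r) * w = j"
      using j unfolding right_simple_def by blast
    have "j * r * (j * (u * r * g - u * r)) = j * r * (g * g - g)"
      by (simp add: g_def algebra_simps)
    also have "\<dots> = 0"
      using jrg by (simp add: right_diff_distrib flip: mult.assoc)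
    finally have "j * r * j = 0"
      using w by (metis mult.assoc mult_zero_left)
    with r show False by simp
  qed
  moreover have "g \<noteq> 0"
    using jrg r by auto
  then obtain w where "g * w = j"
    using j unfolding right_simple_def g_def by blast
  ultimately have "g * j = j"
    by (metis mult.assoc)
  then show ?thesis
    by (metis g_def)
qed simp

text \<open>For the idempotent \<open>e = j * t\<close> with \<open>e * j = j\<close>, the corner
  \<open>e A e\<close> is a division ring. If \<open>r * j \<noteq> 0\<close>, semiprimeness
  produces a nonzero \<open>x = j * w * r * e\<close> in it, and a left inverse \<open>y\<close> of
  \<open>x\<close> gives \<open>y * x * j = j\<close>, which exhibits \<open>j\<close> as a left
  multiple of \<open>r * j\<close>.\<close>

lemma right_simple_imp_left_simple:
  fixes j :: "'a::ring_1"
  assumes sp: "semiprime TYPE('a)" and j: "right_simple j"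
  shows "left_simple j"
  unfolding left_simple_def
proof (intro allI impI)
  fix r assume "r * j \<noteq> 0"
  then obtain w where w: "r * j * w * (r * j) \<noteq> 0"
    using semiprimeD[OF sp] by blast
  obtain t where t: "j * t * j = j"
    using right_simple_regular[OF sp j] by blast
  define e where "e = j * t"
  have ee: "e * e = e" and ej: "e * j = j"
    by (simp_all add: e_def t flip: mult.assoc)
  define x where "x = j * w * r * e"
  have xj: "x * j = j * w * r * j"
    by (simp add: x_def ej mult.assoc)
  have xe: "x * e = x"
    by (simp add: x_def ee mult.assoc)
  have ex: "e * x = x"
    unfolding x_def by (simp add: ej flip: mult.assoc)
  \<comment> \<open>Simplicity of \<open>j\<close> gives \<open>z * y = j\<close>, and multiplying
    by \<open>t\<close> turns \<open>j\<close> into \<open>e\<close>. Only right inverses are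
    obtained this way.\<close>
  have inverse: "\<exists>y. z * y = e \<and> e * y = y \<and> y * e = y"
    if "z \<noteq> 0" "z * e = z" "e * z = z" for z
  proof -
    have "j * (t * z) = z"
      using that(3) by (simp add: e_def mult.assoc)
    moreover from this have "j * (t * z) \<noteq> 0"
      using that(1) by simp
    then obtain y where "j * (t * z) * y = j"
      using j unfolding right_simple_def by blast
    ultimately have y: "z * y = j"
      by simp
    have "z * (e * (y * t) * e) = z * e * y * t * e"
      by (simp add: mult.assoc)
    also have "\<dots> = e"
      using that(2) y ee by (simp flip: e_def)
    finally have "z * (e * (y * t) * e) = e" .
    moreover have "e * (e * (y * t) * e) = e * (y * t) * e"
      using ee by (simp flip: mult.assoc)
    moreover have "e * (y * t) * e * e = e * (y * t) * e"
      using ee by (simp add: mult.assoc)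
    ultimately show ?thesis by blast
  qed
  have "x \<noteq> 0"
    using w xj by (metis mult.assoc mult_zero_left mult_zero_right)
  then obtain y where y: "x * y = e" "e * y = y" "y * e = y"
    using inverse xe ex by blast
  have "y \<noteq> 0"
    using y(1) ej w by auto
  then obtain z where z: "y * z = e" "e * z = z"
    using inverse y by blast
  \<comment> \<open>\<open>x = x * (y * z) = (x * y) * z = z\<close>, so the right inverse
    \<open>y\<close> of \<open>x\<close> is a left inverse as well.\<close>
  have "x = z"
    by (metis mult.assoc xe y(1) z)
  then have "y * x * j = j"
    using z ej by simp
  then have "(y * j * w) * r * j = j"
    by (simp add: xj mult.assoc)
  then show "\<exists>u. u * r * j = j" ..
qed

text \<open>McCoy's lemma. It serves twice: to split off a summand of a socle element, and to lift
  regularity modulo the socle to the ring.\<close>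

lemma regular_if_diff_regular:
  fixes a :: "'a::ring_1"
  assumes "(a - a * q * a) * c * (a - a * q * a) = a - a * q * a"
  shows "\<exists>d. a * d * a = a"
proof -
  have "a * (q + (1 - q * a) * c * (1 - a * q)) * a =
      a * q * a + (a - a * q * a) * c * (a - a * q * a)"
    by (simp add: algebra_simps)
  also have "\<dots> = a"
    by (simp add: assms)
  finally show ?thesis ..
qed

text \<open>One summand is split off at a time. The problem reduces to a left multiple of the tail
  \<open>\<tau>\<close>, again a sum of \<open>n\<close> right simple elements; hence the induction
  on the length, for all lists at once.\<close>

lemma sum_list_right_simple_regular:
  fixes js :: "'a::ring_1 list"
  assumes sp: "semiprime TYPE('a)"
  shows "\<forall>j\<in>set js. right_simple j \<Longrightarrow> \<exists>c. sum_list js * c * sum_list js = sum_list js"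
proof (induction "length js" arbitrary: js)
  case (Suc n)
  then obtain j ks where js: "js = j # ks" and ks: "n = length ks"
    by (metis Suc_length_conv)
  define \<tau> where "\<tau> = sum_list ks"
  have IH: "\<exists>c. sum_list (map ((*) r) ks) * c * sum_list (map ((*) r) ks) = sum_list (map ((*) r) ks)" for r
    using Suc.hyps(1)[of "map ((*) r) ks"] Suc.prems ks js
    by (simp add: right_simple_mult_left)
  then have regular: "\<exists>c. (r * \<tau>) * c * (r * \<tau>) = r * \<tau>" for r
    by (simp add: \<tau>_def sum_list_const_mult)
  have j: "right_simple j"
    using Suc.prems js by simp
  \<comment> \<open>The cases ask whether \<open>j\<close> survives on the right annihilator of
    \<open>\<tau>\<close>. If so, \<open>j * t\<close> is a right multiple of the whole sum, and
    McCoy's lemma leaves \<open>(1 - j * t) * \<tau>\<close>. If not,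
    \<open>j = j * c * \<tau>\<close>, and the sum itself is a left multiple of
    \<open>\<tau>\<close>.\<close>
  show ?case
  proof (cases "\<exists>z. \<tau> * z = 0 \<and> j * z \<noteq> 0")
    case True
    then obtain z where z: "\<tau> * z = 0" "j * z \<noteq> 0" by blast
    obtain u where u: "j * z * u = j"
      using z(2) j unfolding right_simple_def by blast
    obtain t where t: "j * t * j = j"
      using right_simple_regular[OF sp j] by blast
    define \<sigma> where "\<sigma> = sum_list js"
    have \<sigma>: "\<sigma> = j + \<tau>"
      by (simp add: \<sigma>_def js \<tau>_def)
    have "\<sigma> * (z * u * t) = j * z * u * t + \<tau> * z * u * t"
      by (simp add: \<sigma> distrib_right mult.assoc)
    also have "\<dots> = j * t"
      by (simp add: z(1) u)
    finally have "\<sigma> - \<sigma> * (z * u * t) * \<sigma> = \<sigma> - j * t * \<sigma>"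
      by simp
    also have "\<dots> = (1 - j * t) * \<tau>"
      using t by (simp add: \<sigma> algebra_simps)
    finally have *: "\<sigma> - \<sigma> * (z * u * t) * \<sigma> = (1 - j * t) * \<tau>" .
    obtain c where "(1 - j * t) * \<tau> * c * ((1 - j * t) * \<tau>) = (1 - j * t) * \<tau>"
      using regular by blast
    then show ?thesis
      using regular_if_diff_regular[of \<sigma> "z * u * t" c] * unfolding \<sigma>_def by simp
  next
    case False
    obtain c where c: "\<tau> * c * \<tau> = \<tau>"
      using regular[of 1] by auto
    have "\<tau> * (1 - c * \<tau>) = 0"
      using c by (simp add: algebra_simps)
    then have "j * (1 - c * \<tau>) = 0"
      using False by blast
    then have "sum_list js = (1 + j * c) * \<tau>"
      by (simp add: js \<tau>_def algebra_simps)
    then show ?thesis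
      using regular by simp
  qed
qed simp

lemma soc_regular:
  fixes a :: "'a::ring_1"
  assumes "semiprime TYPE('a)" "a \<in> soc"
  shows "\<exists>c. a * c * a = a"
  using assms sum_list_right_simple_regular unfolding soc_eq by blast

section \<open>The descending chain condition for left ideals below a socle element\<close>

definition left_ideal :: "'a::ring_1 set \<Rightarrow> bool" where
  "left_ideal J \<longleftrightarrow> 0 \<in> J \<and> (\<forall>a\<in>J. \<forall>b\<in>J. a + b \<in> J) \<and> (\<forall>a\<in>J. \<forall>r. r * a \<in> J)"

lemma left_ideal_diff: "left_ideal J \<Longrightarrow> a \<in> J \<Longrightarrow> b \<in> J \<Longrightarrow> a - b \<in> J"
  unfolding left_ideal_def by (metis diff_conv_add_uminus mult_minus1)

lemma left_ideal_Int: "left_ideal I \<Longrightarrow> left_ideal J \<Longrightarrow> left_ideal (I \<inter> J)"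
  by (auto simp: left_ideal_def)

lemma left_ideal_range: "left_ideal (range (\<lambda>a. a * (y::'a::ring_1)))"
proof -
  have "u * y + v * y \<in> range (\<lambda>a. a * y)" for u v
    by (metis distrib_right rangeI)
  moreover have "r * (u * y) \<in> range (\<lambda>a. a * y)" for r u
    by (metis mult.assoc rangeI)
  ultimately show ?thesis
    by (auto simp: left_ideal_def intro: image_eqI[of _ _ 0])
qed

lemma left_ideal_left_annihilator: "left_ideal (left_annihilator y)"
  by (auto simp: left_ideal_def left_annihilator_def distrib_right mult.assoc)

fun left_span :: "'a::ring_1 list \<Rightarrow> 'a set" where
  "left_span [] = {0}"
| "left_span (j # js) = {m + r * j | m r. m \<in> left_span js}"

lemma left_ideal_left_span: "left_ideal (left_span js)"
proof (induction js)
  case (Cons j js)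
  have "\<exists>m r. 0 = m + r * j \<and> m \<in> left_span js"
    using Cons by (intro exI[of _ 0]) (auto simp: left_ideal_def)
  moreover have "\<exists>n t. m + r * j + (m' + r' * j) = n + t * j \<and> n \<in> left_span js"
    if "m \<in> left_span js" "m' \<in> left_span js" for m m' r r'
    using Cons that
    by (intro exI[of _ "m + m'"] exI[of _ "r + r'"]) (auto simp: left_ideal_def algebra_simps)
  moreover have "\<exists>n t. s * (m + r * j) = n + t * j \<and> n \<in> left_span js"
    if "m \<in> left_span js" for m r s
    using Cons that
    by (intro exI[of _ "s * m"] exI[of _ "s * r"]) (auto simp: left_ideal_def algebra_simps)
  ultimately show ?case
    by (auto simp: left_ideal_def)
qed (simp add: left_ideal_def)

lemma mult_sum_list_in_left_span: "r * sum_list js \<in> left_span js"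
proof (induction js)
  case (Cons j js)
  then show ?case
    by (simp add: distrib_left add.commute) (metis add.commute)
qed simp

text \<open>Induction as for modules of finite length. Modulo the span \<open>M\<close> of the tail,
  a member of the chain is either zero or everything. If no member is zero there, the trace on
  \<open>M\<close> determines the ideal, and these traces stabilise by induction.\<close>

lemma left_span_DCC:
  fixes I :: "nat \<Rightarrow> 'a::ring_1 set"
  assumes "\<forall>j\<in>set js. left_simple j" "\<And>n. left_ideal (I n)" "decseq I"
    and "\<And>n. I n \<subseteq> left_span js"
  shows "\<exists>N. \<forall>n\<ge>N. I n = I N"
  using assms
proof (induction js arbitrary: I)
  case Nil
  then have "I n = {0}" for n
    unfolding left_ideal_def left_span.simps by blast
  then show ?case by simp
next
  case (Cons j js)
  define M where "M = left_span js"
  have M: "left_ideal M"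
    unfolding M_def by (rule left_ideal_left_span)
  have j: "left_simple j"
    using Cons.prems by simp
  have "decseq (\<lambda>n. I n \<inter> M)"
    using Cons.prems(3) by (auto simp: decseq_def)
  then have "\<exists>N. \<forall>n\<ge>N. I n \<inter> M = I N \<inter> M"
    using Cons.prems M by (intro Cons.IH) (auto intro: left_ideal_Int simp: M_def)
  then obtain N where N: "\<And>n. n \<ge> N \<Longrightarrow> I n \<inter> M = I N \<inter> M"
    by blast
  show ?case
  proof (cases "\<exists>K. I K \<subseteq> M")
    case True
    then obtain K where K: "I K \<subseteq> M" by blast
    then have "I n = I n \<inter> M" if "n \<ge> K" for n
      using Cons.prems(3) that unfolding decseq_def by blast
    then have "I n = I (max N K)" if "n \<ge> max N K" for n
      using N that by (metis max.bounded_iff max.cobounded1 max.cobounded2)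
    then show ?thesis by blast
  next
    case False
    have "z \<in> I n" if n: "n \<ge> N" and z: "z \<in> I N" for n z
    proof -
      obtain i where i: "i \<in> I n" "i \<notin> M"
        using False by blast
      then obtain m r where mr: "i = m + r * j" "m \<in> M"
        using Cons.prems(4) unfolding M_def by fastforce
      have "r * j \<noteq> 0"
        using i mr by auto
      then obtain u where u: "u * r * j = j"
        using j unfolding left_simple_def by blast
      obtain m' r' where z': "z = m' + r' * j" "m' \<in> M"
        using z Cons.prems(4) unfolding M_def by fastforce
      \<comment> \<open>A left multiple of \<open>i\<close> with the same \<open>j\<close>-component
        as \<open>z\<close>. The difference falls into \<open>M\<close>, where \<open>I n\<close>
        and \<open>I N\<close> agree.\<close>
      define i' where "i' = r' * u * i"
      have i': "i' \<in> I n"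
        using i Cons.prems(2) by (auto simp: i'_def left_ideal_def)
      have "r' * u * (r * j) = r' * j"
        by (metis u mult.assoc)
      then have "z - i' = m' - r' * u * m"
        by (simp add: z' i'_def mr distrib_left)
      also have "\<dots> \<in> M"
        using M mr(2) z'(2) by (intro left_ideal_diff) (auto simp: left_ideal_def)
      finally have "z - i' \<in> I N \<inter> M"
        using z i' n Cons.prems(2,3) left_ideal_diff unfolding decseq_def by blast
      then have "z - i' \<in> I n"
        using N[OF n] by blast
      then have "z - i' + i' \<in> I n"
        using i' Cons.prems(2)[of n] unfolding left_ideal_def by blast
      then show ?thesis by simp
    qed
    then have "I n = I N" if "n \<ge> N" for n
      using that Cons.prems(3) unfolding decseq_def by blast
    then show ?thesis by blast
  qed
qed

text \<open>The socle is built from minimal right ideals, but the chain consists of left ideals; the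
  passage from right simple to left simple summands bridges the two sides.\<close>

lemma soc_DCC:
  fixes I :: "nat \<Rightarrow> 'a::ring_1 set"
  assumes "semiprime TYPE('a)" "\<sigma> \<in> soc" "\<And>n. left_ideal (I n)" "decseq I"
    and "\<And>n. I n \<subseteq> range (\<lambda>r. r * \<sigma>)"
  shows "\<exists>N. \<forall>n\<ge>N. I n = I N"
proof -
  obtain js where js: "\<sigma> = sum_list js" "\<forall>j\<in>set js. right_simple j"
    using assms(2) unfolding soc_eq by blast
  show ?thesis
  proof (rule left_span_DCC[where js = js])
    show "\<forall>j\<in>set js. left_simple j"
      using js right_simple_imp_left_simple[OF assms(1)] by blast
    show "I n \<subseteq> left_span js" for n
      using assms(5)[of n] mult_sum_list_in_left_span[of _ js] js by fastforce
  qed (use assms in auto)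
qed

section \<open>B-Fredholm elements\<close>

lemma B_Fredholm_witness:
  fixes a :: "'a::ring_1"
  assumes "B_Fredholm a"
  obtains b k where "a * b - b * a \<in> soc" "a ^ k - a ^ k * b * a \<in> soc"
proof -
  let ?R = "ring_of_type_algebra :: 'a ring"
  interpret ideal "soc :: 'a set" ?R by (rule ideal_soc)
  interpret h: ring_hom_ring ?R "?R Quot soc" "(+>\<^bsub>?R\<^esub>) soc"
    by (rule rcos_ring_hom_ring)
  let ?h = "(+>\<^bsub>?R\<^esub>) (soc :: 'a set)"
  obtain B and k :: nat where B: "B \<in> carrier (?R Quot soc)"
    "?h a \<otimes>\<^bsub>?R Quot soc\<^esub> B = B \<otimes>\<^bsub>?R Quot soc\<^esub> ?h a"
    "?h a [^]\<^bsub>?R Quot soc\<^esub> k \<otimes>\<^bsub>?R Quot soc\<^esub> B \<otimes>\<^bsub>?R Quot soc\<^esub> ?h a = ?h a [^]\<^bsub>?R Quot soc\<^esub> k"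
    using assms unfolding B_Fredholm_def drazin_invertible_def by blast
  obtain b where b: "B = ?h b"
    using B(1) by (auto simp: FactRing_def A_RCOSETS_def RCOSETS_def a_r_coset_def)
  have hmult: "?h u \<otimes>\<^bsub>?R Quot soc\<^esub> ?h v = ?h (u * v)" for u v
    using h.hom_mult[of u v] by simp
  have hpow: "?h a [^]\<^bsub>?R Quot soc\<^esub> k = ?h (a ^ k)"
    using h.hom_nat_pow[of a k] by simp
  have heq: "u - v \<in> soc" if "?h u = ?h v" for u v
  proof -
    have "u \<in> ?h v"
      using that a_rcos_self[of u] by simp
    then obtain s where "s \<in> soc" "u = s + v"
      by (auto simp: a_r_coset_def')
    then show ?thesis by simp
  qed
  show thesis
  proof (rule that)
    show "a * b - b * a \<in> soc"
      using B(2) by (intro heq) (simp add: b hmult)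
    show "a ^ k - a ^ k * b * a \<in> soc"
      using B(3) by (intro heq) (simp add: b hmult hpow)
  qed
qed

lemma cong_soc_trans: "a - b \<in> soc \<Longrightarrow> b - c \<in> soc \<Longrightarrow> a - c \<in> soc"
  using soc_add[of "a - b" "b - c"] by simp

lemma cong_soc_mult:
  assumes "a - b \<in> soc"
  shows "r * a * t - r * b * t \<in> soc"
  using soc_mult_right[OF soc_mult_left[OF assms, of r], of t] by (simp add: algebra_simps)

lemma cong_soc_commute_power:
  assumes "a * b - b * a \<in> soc"
  shows "a * b ^ n - b ^ n * a \<in> soc"
proof (induction n)
  case (Suc n)
  have "a * b ^ Suc n - b * a * b ^ n \<in> soc"
    using cong_soc_mult[OF assms, of 1 "b ^ n"] by (simp add: mult.assoc)
  moreover have "b * a * b ^ n - b ^ Suc n * a \<in> soc"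
    using cong_soc_mult[OF Suc, of b 1] by (simp add: mult.assoc)
  ultimately show ?case
    by (rule cong_soc_trans)
qed (simp add: zero_in_soc)

lemma soc_diff_swap: "a - b \<in> soc \<Longrightarrow> b - a \<in> soc"
  using soc_diff[OF zero_in_soc] by fastforce

text \<open>Modulo the socle, \<open>a ^ n = a ^ n * b ^ n * a ^ n\<close> for
  \<open>n \<ge> k\<close>; regularity of socle elements and McCoy's lemma lift this to the ring.
  The left ideals in the second claim lie, for \<open>n \<ge> k\<close>, below the single socle
  element \<open>a ^ k - a ^ k * a * b\<close>, so the chain condition applies.\<close>

lemma B_Fredholm_structure:
  fixes a :: "'a::ring_1"
  assumes sp: "semiprime TYPE('a)" and a: "B_Fredholm a"
  obtains d where
    "\<And>n. n \<ge> d \<Longrightarrow> \<exists>c. a ^ n * c * a ^ n = a ^ n"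
    "\<And>n. n \<ge> d \<Longrightarrow> left_annihilator a \<inter> range (\<lambda>u. u * a ^ n) = left_annihilator a \<inter> range (\<lambda>u. u * a ^ d)"
proof -
  obtain b k where b: "a * b - b * a \<in> soc" "a ^ k - a ^ k * b * a \<in> soc"
    using B_Fredholm_witness[OF a] .
  have "a ^ k * (b * a) - a ^ k * (a * b) \<in> soc"
    using cong_soc_mult[OF soc_diff_swap[OF b(1)], of "a ^ k" 1] by simp
  then have \<sigma>: "a ^ k - a ^ k * a * b \<in> soc"
    using cong_soc_trans[OF b(2)] by (simp add: mult.assoc)
  have step: "a ^ n - a ^ Suc n * b \<in> soc" if "n \<ge> k" for n
  proof -
    have "a ^ (n - k) * (a ^ k * a * b) = a ^ Suc n * b"
      using that by (metis le_add_diff_inverse2 mult.assoc power_Suc2 power_add)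
    moreover have "a ^ (n - k) * a ^ k = a ^ n"
      using that by (simp flip: power_add)
    ultimately show ?thesis
      using cong_soc_mult[OF \<sigma>, of "a ^ (n - k)" 1] by simp
  qed
  have absorb: "a ^ n - a ^ (m + n) * b ^ m \<in> soc" if "n \<ge> k" for n m
  proof (induction m)
    case (Suc m)
    have "a ^ (m + n) * b ^ m - a ^ Suc (m + n) * b * b ^ m \<in> soc"
      using cong_soc_mult[OF step[of "m + n"], of 1 "b ^ m"] that by simp
    then show ?case
      using cong_soc_trans[OF Suc] by (simp add: mult.assoc)
  qed (simp add: zero_in_soc)
  \<comment> \<open>The commutation lemma is used twice: for powers of \<open>b\<close>, then, with
    the roles exchanged, for powers of \<open>a\<close>.\<close>
  have comm: "a ^ m * b ^ n - b ^ n * a ^ m \<in> soc" for m n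
  proof (rule soc_diff_swap, rule cong_soc_commute_power)
    show "b ^ n * a - a * b ^ n \<in> soc"
      by (rule soc_diff_swap[OF cong_soc_commute_power[OF b(1)]])
  qed
  have regular: "\<exists>c. a ^ n * c * a ^ n = a ^ n" if n: "n \<ge> k" for n
  proof -
    have "a ^ n * (a ^ n * b ^ n) - a ^ n * (b ^ n * a ^ n) \<in> soc"
      using cong_soc_mult[OF comm, of "a ^ n" n n 1] by simp
    then have "a ^ n - a ^ n * b ^ n * a ^ n \<in> soc"
      using cong_soc_trans[OF absorb[OF n, of n]] by (simp add: power_add mult.assoc)
    then obtain c where "(a ^ n - a ^ n * b ^ n * a ^ n) * c * (a ^ n - a ^ n * b ^ n * a ^ n)
        = a ^ n - a ^ n * b ^ n * a ^ n"
      using soc_regular[OF sp] by blast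
    then show ?thesis
      by (rule regular_if_diff_regular)
  qed
  \<comment> \<open>The shift by \<open>k\<close> puts the whole chain, and not only its tail, below
    the socle element.\<close>
  define I where "I n = left_annihilator a \<inter> range (\<lambda>u. u * a ^ (n + k))" for n
  have I_left: "left_ideal (I n)" for n
    unfolding I_def
    by (intro left_ideal_Int left_ideal_left_annihilator left_ideal_range)
  have I_dec: "decseq I"
    unfolding decseq_Suc_iff I_def
    by (auto simp: power_Suc simp flip: mult.assoc)
  have I_soc: "I n \<subseteq> range (\<lambda>r. r * (a ^ k - a ^ k * a * b))" for n
  proof
    fix z assume "z \<in> I n"
    then have "z \<in> I 0"
      using I_dec unfolding decseq_def by blast
    then obtain u where u: "z = u * a ^ k" "z * a = 0"
      by (auto simp: I_def left_annihilator_def)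
    \<comment> \<open>The subtracted term contributes
      \<open>u * a ^ k * a * b = z * a * b = 0\<close>.\<close>
    then have "z = u * (a ^ k - a ^ k * a * b)"
      by (simp add: right_diff_distrib flip: mult.assoc)
    then show "z \<in> range (\<lambda>r. r * (a ^ k - a ^ k * a * b))"
      by blast
  qed
  obtain N where N: "\<And>n. n \<ge> N \<Longrightarrow> I n = I N"
    using soc_DCC[OF sp \<sigma> I_left I_dec I_soc] by blast
  show thesis
  proof (rule that[of "N + k"])
    fix n assume n: "n \<ge> N + k"
    show "\<exists>c. a ^ n * c * a ^ n = a ^ n"
      using regular n by simp
    show "left_annihilator a \<inter> range (\<lambda>u. u * a ^ n) = left_annihilator a \<inter> range (\<lambda>u. u * a ^ (N + k))"
      using N[of "n - k"] n by (simp add: I_def)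
  qed
qed

section \<open>The hyperrange of a B-Fredholm element\<close>

definition hyperkernel :: "'a::ring_1 \<Rightarrow> 'a set" where
  "hyperkernel y = (\<Union>n\<in>{1..}. left_annihilator (y ^ n))"

definition hyperrange :: "'a::ring_1 \<Rightarrow> 'a set" where
  "hyperrange y = (\<Inter>n\<in>{1..}. range (\<lambda>a. a * y ^ n))"

lemma range_mult_power_antimono:
  fixes y :: "'a::ring_1"
  assumes "m \<le> n"
  shows "range (\<lambda>a. a * y ^ n) \<subseteq> range (\<lambda>a. a * y ^ m)"
proof -
  have "a * y ^ n = a * y ^ (n - m) * y ^ m" for a
    using assms by (simp add: mult.assoc flip: power_add)
  then show ?thesis by auto
qed

lemma left_annihilator_power_mono:
  fixes y :: "'a::ring_1"
  assumes "m \<le> n"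
  shows "left_annihilator (y ^ m) \<subseteq> left_annihilator (y ^ n)"
proof -
  have "a * y ^ n = a * y ^ m * y ^ (n - m)" for a
    using assms by (simp add: mult.assoc flip: power_add)
  then show ?thesis by (auto simp: left_annihilator_def)
qed

lemma left_ideal_INT: "(\<And>i. i \<in> I \<Longrightarrow> left_ideal (J i)) \<Longrightarrow> left_ideal (\<Inter>i\<in>I. J i)"
  by (auto simp: left_ideal_def)

lemma left_ideal_hyperrange: "left_ideal (hyperrange y)"
  unfolding hyperrange_def by (intro left_ideal_INT left_ideal_range)

lemma hyperrangeE:
  assumes "w \<in> hyperrange y"
  obtains u where "w = u * y ^ n"
proof (cases "n = 0")
  case True
  then show thesis
    using that[of w] by simp
next
  case False
  then have "w \<in> range (\<lambda>a. a * y ^ n)"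
    using assms unfolding hyperrange_def by simp
  then show thesis
    using that by blast
qed

lemma zero_in_hyperrange: "0 \<in> hyperrange y"
  using left_ideal_hyperrange by (auto simp: left_ideal_def)

lemma zero_in_left_annihilator: "0 \<in> left_annihilator y"
  by (simp add: left_annihilator_def)

text \<open>Regularity of \<open>y ^ Suc d\<close> supplies \<open>s\<close>. The point is that
  \<open>w * s\<close> stays in the hyperrange: it differs from a preimage of \<open>w\<close> in
  \<open>A y^m\<close> by an element of \<open>L(y) \<inter> A y^d\<close>, and for
  \<open>m \<ge> d\<close> this is the same as \<open>L(y) \<inter> A y^m\<close>.\<close>

lemma hyperrange_lift:
  fixes y :: "'a::ring_1"
  assumes sp: "semiprime TYPE('a)" and y: "B_Fredholm y"
  obtains s where "\<And>w. w \<in> hyperrange y \<Longrightarrow> w * s \<in> hyperrange y"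
    and "\<And>w. w \<in> hyperrange y \<Longrightarrow> w * s * y = w"
proof -
  obtain d where regular: "\<And>n. n \<ge> d \<Longrightarrow> \<exists>c. y ^ n * c * y ^ n = y ^ n" and
    stable: "\<And>n. n \<ge> d \<Longrightarrow> left_annihilator y \<inter> range (\<lambda>u. u * y ^ n) =
      left_annihilator y \<inter> range (\<lambda>u. u * y ^ d)"
    using B_Fredholm_structure[OF sp y] by blast
  obtain c where c: "y ^ Suc d * c * y ^ Suc d = y ^ Suc d"
    using regular[of "Suc d"] by auto
  \<comment> \<open>One factor \<open>y\<close> less than in \<open>c * y ^ Suc d\<close>; the
    missing one is supplied by \<open>w * s * y\<close>.\<close>
  define s where "s = c * y ^ d"
  have lift: "w * s * y = w" if w: "w \<in> hyperrange y" for w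
  proof -
    obtain u where u: "w = u * y ^ Suc d"
      using hyperrangeE[OF w] .
    have "w * s * y = u * (y ^ Suc d * c * y ^ Suc d)"
      unfolding u s_def by (simp only: mult.assoc power_Suc2)
    then show ?thesis
      by (simp only: c u)
  qed
  have "w * s \<in> hyperrange y" if w: "w \<in> hyperrange y" for w
    unfolding hyperrange_def
  proof
    fix n :: nat
    define m where "m = max n d"
    obtain u where u: "w = u * y ^ m * y"
      using hyperrangeE[OF w, of "Suc m"] by (metis mult.assoc power_Suc2)
    define z where "z = w * s - u * y ^ m"
    have "w * s = w * c * y ^ d"
      by (simp add: s_def mult.assoc)
    then have "w * s \<in> range (\<lambda>u. u * y ^ d)"
      by blast
    moreover have "u * y ^ m \<in> range (\<lambda>u. u * y ^ d)"
      using range_mult_power_antimono[of d m y] by (auto simp: m_def)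
    ultimately have "z \<in> range (\<lambda>u. u * y ^ d)"
      unfolding z_def by (intro left_ideal_diff left_ideal_range)
    moreover have "z * y = 0"
      using lift[OF w] u by (simp add: z_def left_diff_distrib)
    ultimately have "z \<in> range (\<lambda>u. u * y ^ m)"
      using stable[of m] by (auto simp: m_def left_annihilator_def)
    then obtain t where "z = t * y ^ m"
      by blast
    then have "w * s = (t + u) * y ^ m"
      by (simp add: z_def algebra_simps)
    then have "w * s \<in> range (\<lambda>u. u * y ^ m)"
      by blast
    then show "w * s \<in> range (\<lambda>u. u * y ^ n)"
      using range_mult_power_antimono[of n m y] by (auto simp: m_def)
  qed
  with lift that show thesis by blast
qed

text \<open>The regularity defect \<open>z\<close>, taken one power too low, is annihilated by
  \<open>y\<close> and lies in \<open>A y^d\<close>. Stability moves it into every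
  \<open>A y^n\<close>, hence into the hyperrange, so it vanishes.\<close>

lemma power_descends:
  fixes y :: "'a::ring_1"
  assumes sp: "semiprime TYPE('a)" and y: "B_Fredholm y"
    and N: "left_annihilator y \<inter> hyperrange y = {0}"
  shows "\<exists>n c. y ^ n = y ^ Suc n * c"
proof -
  obtain d where regular: "\<And>n. n \<ge> d \<Longrightarrow> \<exists>c. y ^ n * c * y ^ n = y ^ n" and
    stable: "\<And>n. n \<ge> d \<Longrightarrow> left_annihilator y \<inter> range (\<lambda>u. u * y ^ n) =
      left_annihilator y \<inter> range (\<lambda>u. u * y ^ d)"
    using B_Fredholm_structure[OF sp y] by blast
  obtain c where c: "y ^ Suc d * c * y ^ Suc d = y ^ Suc d"
    using regular[of "Suc d"] by auto
  define z where "z = (1 - y ^ Suc d * c) * y ^ d"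
  have "z * y = y ^ Suc d - y ^ Suc d * c * y ^ Suc d"
    unfolding z_def by (simp only: left_diff_distrib mult_1_left mult.assoc power_Suc2)
  then have "z * y = 0"
    by (simp only: c diff_self)
  then have z: "z \<in> left_annihilator y \<inter> range (\<lambda>u. u * y ^ d)"
    by (simp add: left_annihilator_def z_def)
  have "z \<in> range (\<lambda>u. u * y ^ n)" for n
  proof (cases "n \<ge> d")
    case True
    then show ?thesis using z stable by blast
  next
    case False
    then show ?thesis using z range_mult_power_antimono[of n d y] by auto
  qed
  then have "z \<in> left_annihilator y \<inter> hyperrange y"
    using z unfolding hyperrange_def by blast
  then have "z = 0"
    using N by blast
  then have "y ^ d = y ^ Suc d * (c * y ^ d)"
    by (simp add: z_def left_diff_distrib mult.assoc)
  then show ?thesis by blast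
qed

section \<open>Ascent and descent of multiplication operators\<close>

lemma funpow_mult_right: "((\<lambda>a. a * x) ^^ n) v = v * x ^ n" for x :: "'a::ring_1"
  by (induction n arbitrary: v) (simp_all add: mult.assoc power_commutes)

lemma funpow_mult_left: "((\<lambda>a. x * a) ^^ n) v = x ^ n * v" for x :: "'a::ring_1"
  by (induction n arbitrary: v) (simp_all add: mult.assoc)

lemma right_ascent_eq:
  "right_ascent y = Inf {enat n | n. left_annihilator (y ^ n) = left_annihilator (y ^ Suc n)}"
  unfolding right_ascent_def ascent_def funpow_mult_right left_annihilator_def ..

lemma Inf_enat_less_infinity_iff: "Inf {enat n | n. P n} < \<infinity> \<longleftrightarrow> (\<exists>n. P n)"
proof
  assume "Inf {enat n | n. P n} < \<infinity>"
  then show "\<exists>n. P n"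
    unfolding Inf_less_iff by blast
next
  assume "\<exists>n. P n"
  then show "Inf {enat n | n. P n} < \<infinity>"
    unfolding Inf_less_iff using enat_ord_simps(4) by blast
qed

lemma right_ascent_finite_iff:
  "right_ascent y < \<infinity> \<longleftrightarrow> (\<exists>n. left_annihilator (y ^ n) = left_annihilator (y ^ Suc n))"
  unfolding right_ascent_eq by (rule Inf_enat_less_infinity_iff)

text \<open>\<open>enat\<close> is well-ordered, so the infimum is attained and the annihilators are
  stable at the ascent itself.\<close>

lemma right_ascent_finiteE:
  assumes "right_ascent y < \<infinity>"
  obtains p where "right_ascent y = enat p" "left_annihilator (y ^ p) = left_annihilator (y ^ Suc p)"
proof -
  let ?S = "{enat n | n. left_annihilator (y ^ n) = left_annihilator (y ^ Suc n)}"
  have "?S \<noteq> {}"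
    using assms unfolding right_ascent_finite_iff by blast
  then obtain k where "k \<in> ?S"
    by blast
  then have "right_ascent y \<in> ?S"
    unfolding right_ascent_eq by (rule wellorder_InfI)
  then show thesis
    using that by blast
qed

text \<open>The range of left multiplication by \<open>y ^ n\<close> is the right ideal generated by
  \<open>y ^ n\<close>, so equality of consecutive ranges is one equation, tested at 1.\<close>

lemma left_descent_finite_iff:
  "left_descent y < \<infinity> \<longleftrightarrow> (\<exists>n c. y ^ n = y ^ Suc n * c)"
proof -
  have *: "range ((\<lambda>a. y * a) ^^ n) = range ((\<lambda>a. y * a) ^^ Suc n) \<longleftrightarrow> (\<exists>c. y ^ n = y ^ Suc n * c)" for n
    unfolding funpow_mult_left[abs_def]
  proof
    assume "range ((*) (y ^ n)) = range ((*) (y ^ Suc n))"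
    then show "\<exists>c. y ^ n = y ^ Suc n * c"
      by (metis (no_types, lifting) imageE mult.right_neutral rangeI)
  next
    assume "\<exists>c. y ^ n = y ^ Suc n * c"
    then obtain c where "y ^ n = y ^ Suc n * c" ..
    then have "y ^ n * v = y ^ Suc n * (c * v)" for v
      by (metis mult.assoc)
    moreover have "y ^ Suc n * v = y ^ n * (y * v)" for v
      by (simp add: mult.assoc power_Suc2 del: power_Suc)
    ultimately show "range ((*) (y ^ n)) = range ((*) (y ^ Suc n))"
      by (metis (no_types, lifting) image_subset_iff rangeI subset_antisym)
  qed
  show ?thesis
    unfolding left_descent_def descent_def Inf_enat_less_infinity_iff * ..
qed

lemma left_annihilator_power_stable:
  fixes y :: "'a::ring_1"
  assumes "left_annihilator (y ^ p) = left_annihilator (y ^ Suc p)"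
  shows "left_annihilator (y ^ (p + j)) = left_annihilator (y ^ p)"
proof (induction j)
  case (Suc j)
  have "a \<in> left_annihilator (y ^ (p + j))" if "a \<in> left_annihilator (y ^ (p + Suc j))" for a
  proof -
    have "a * y ^ j * y ^ Suc p = 0"
      using that by (simp add: left_annihilator_def mult.assoc add.commute flip: power_add power_Suc)
    then have "a * y ^ j * y ^ p = 0"
      using assms unfolding left_annihilator_def by blast
    then show ?thesis
      by (simp add: left_annihilator_def mult.assoc add.commute flip: power_add)
  qed
  then show ?case
    using left_annihilator_power_mono[of "p + j" "p + Suc j" y] Suc by auto
qed simp

lemma hyperkernel_eq:
  fixes y :: "'a::ring_1"
  assumes "left_annihilator (y ^ p) = left_annihilator (y ^ Suc p)"
  shows "hyperkernel y = left_annihilator (y ^ p)"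
proof
  show "hyperkernel y \<subseteq> left_annihilator (y ^ p)"
  proof -
    have "left_annihilator (y ^ n) \<subseteq> left_annihilator (y ^ p)" for n
      using left_annihilator_power_mono[of n "p + n" y] left_annihilator_power_stable[OF assms, of n]
      by auto
    then show ?thesis
      by (auto simp: hyperkernel_def)
  qed
  show "left_annihilator (y ^ p) \<subseteq> hyperkernel y"
    \<comment> \<open>The union starts at exponent 1 and \<open>p\<close> may be 0, so the exponent
      is first raised to \<open>Suc p\<close>.\<close>
    unfolding assms hyperkernel_def by auto
qed

text \<open>If \<open>z = a * y ^ p\<close> is annihilated by \<open>y ^ p\<close>, then
  \<open>a\<close> is annihilated by \<open>y ^ (p + p)\<close>, hence already by
  \<open>y ^ p\<close>, so \<open>z = 0\<close>.\<close>

lemma hyperkernel_Int_hyperrange: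
  fixes y :: "'a::ring_1"
  assumes p: "left_annihilator (y ^ p) = left_annihilator (y ^ Suc p)"
  shows "hyperkernel y \<inter> hyperrange y = {0}"
proof -
  have "z = 0" if z: "z \<in> hyperkernel y" "z \<in> hyperrange y" for z
  proof -
    obtain a where a: "z = a * y ^ p"
      using hyperrangeE[OF z(2)] .
    have "z * y ^ p = 0"
      using z(1) unfolding hyperkernel_eq[OF p] left_annihilator_def by simp
    then have "a \<in> left_annihilator (y ^ (p + p))"
      by (simp add: a left_annihilator_def power_add mult.assoc)
    then have "a \<in> left_annihilator (y ^ p)"
      using left_annihilator_power_stable[OF p] by simp
    then show ?thesis
      using a by (simp add: left_annihilator_def)
  qed
  moreover have "0 \<in> hyperkernel y"
    by (auto simp: hyperkernel_def left_annihilator_def)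
  ultimately show ?thesis
    using zero_in_hyperrange by blast
qed

lemma left_annihilator_Int_hyperrange:
  fixes y :: "'a::ring_1"
  assumes "hyperkernel y \<inter> hyperrange y = {0}"
  shows "left_annihilator y \<inter> hyperrange y = {0}"
proof -
  have "left_annihilator (y ^ 1) \<subseteq> hyperkernel y"
    unfolding hyperkernel_def by blast
  then show ?thesis
    using assms zero_in_hyperrange[of y] zero_in_left_annihilator[of y] by auto
qed

lemma left_annihilator_stable_if_descends:
  fixes y :: "'a::ring_1"
  assumes "y ^ n = y ^ Suc n * c"
  shows "left_annihilator (y ^ n) = left_annihilator (y ^ Suc n)"
proof
  have "a * y ^ n = 0" if "a * y ^ Suc n = 0" for a
    by (metis assms mult.assoc mult_zero_left that)
  then show "left_annihilator (y ^ Suc n) \<subseteq> left_annihilator (y ^ n)"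
    unfolding left_annihilator_def by blast
qed (rule left_annihilator_power_mono, simp)

text \<open>\<open>c\<close> need not commute with \<open>y\<close>: the inner factor
  \<open>y ^ Suc n * c\<close> collapses to \<open>y ^ n\<close>, and the powers of \<open>c\<close>
  collect on the right.\<close>

lemma descends_iterate:
  fixes y :: "'a::ring_1"
  assumes "y ^ n = y ^ Suc n * c"
  shows "y ^ n = y ^ (n + j) * c ^ j"
proof (induction j)
  case (Suc j)
  have "y ^ (n + Suc j) * c ^ Suc j = y ^ j * (y ^ Suc n * c) * c ^ j"
    by (simp add: mult.assoc add.commute power_add)
      (simp add: power_commutes flip: mult.assoc)
  also have "\<dots> = y ^ (n + j) * c ^ j"
    by (simp only: assms[symmetric]) (simp add: add.commute flip: power_add)
  finally show ?case
    using Suc by simp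
qed simp

section \<open>Banach-space-valued holomorphic functions\<close>

text \<open>Hahn-Banach: Zorn's lemma is applied to graphs \<open>G \<subseteq> 'a \<times> \<real>\<close> of linear functionals; a subspace
  \<open>G\<close> with \<open>r \<le> norm w\<close> on \<open>G\<close> is automatically single-valued.\<close>

lemma exists_bounded_linear_nonzero:
  fixes v :: "'a::real_normed_vector"
  assumes v: "v \<noteq> 0"
  shows "\<exists>g :: 'a \<Rightarrow> real. bounded_linear g \<and> g v \<noteq> 0"
proof -
  define A where "A = {G :: ('a \<times> real) set. subspace G \<and> (v, norm v) \<in> G \<and> (\<forall>(w, r)\<in>G. r \<le> norm w)}"
  have "span {(v, norm v)} \<in> A"
  proof -
    have "c * norm v \<le> norm (c *\<^sub>R v)" for c
      by (simp add: mult_right_mono)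
    then have "r \<le> norm w" if "(w, r) \<in> span {(v, norm v)}" for w r
      using that by (auto simp: span_singleton)
    then show ?thesis
      by (auto simp: A_def span_base)
  qed
  moreover have "\<Union>C \<in> A" if C: "C \<noteq> {}" "subset.chain A C" for C
  proof -
    have CA: "C \<subseteq> A" and ordered: "\<forall>G\<in>C. \<forall>H\<in>C. G \<subseteq> H \<or> H \<subseteq> G"
      using C(2) unfolding subset_chain_def by blast+
    have "subspace (\<Union>C)"
      unfolding subspace_def
    proof (intro conjI ballI allI)
      show "0 \<in> \<Union>C"
        using C(1) CA by (auto simp: A_def subspace_def)
      fix x assume x: "x \<in> \<Union>C"
      show "c *\<^sub>R x \<in> \<Union>C" for c
        using x CA by (fastforce simp: A_def subspace_def)
      fix y assume y: "y \<in> \<Union>C"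
      obtain G H where GH: "x \<in> G" "G \<in> C" "y \<in> H" "H \<in> C"
        using x y by blast
      then obtain Z where Z: "Z \<in> C" "x \<in> Z" "y \<in> Z"
        using ordered by blast
      then have "subspace Z"
        using CA by (auto simp: A_def)
      then show "x + y \<in> \<Union>C"
        using Z unfolding subspace_def by blast
    qed
    moreover have "(v, norm v) \<in> \<Union>C"
      using C(1) CA unfolding A_def by blast
    moreover have "\<forall>(w, r)\<in>\<Union>C. r \<le> norm w"
      using CA unfolding A_def by blast
    ultimately show ?thesis
      by (simp add: A_def)
  qed
  ultimately obtain M where M: "M \<in> A" and max: "\<And>G. G \<in> A \<Longrightarrow> M \<subseteq> G \<Longrightarrow> G = M"
    using subset_Zorn_nonempty[of A] by blast
  have le: "r \<le> norm w" if "(w, r) \<in> M" for w r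
    using M that by (auto simp: A_def)
  have vM: "(v, norm v) \<in> M" and sub: "subspace M"
    using M by (auto simp: A_def)
  have add: "(w + w', r + r') \<in> M" if "(w, r) \<in> M" "(w', r') \<in> M" for w w' r r'
    using subspace_add[OF sub that] by simp
  have scale: "(c *\<^sub>R w, c * r) \<in> M" if "(w, r) \<in> M" for c w r
    using subspace_scale[OF sub that] by simp
  have total: "\<exists>r. (w, r) \<in> M" for w
  proof -
    \<comment> \<open>The lower bounds that norm domination imposes on a value at \<open>w\<close>.
      By \<open>bound\<close> each lies below every upper bound \<open>norm (u' + w) - r'\<close>,
      so the supremum is an admissible value.\<close>
    define S where "S = (\<lambda>(u, r). r - norm (u - w)) ` M"
    have bound: "r - norm (u - w) \<le> norm (u' + w) - r'" if "(u, r) \<in> M" "(u', r') \<in> M" for u r u' r'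
    proof -
      have "r + r' \<le> norm (u + u')"
        using le[OF add[OF that]] .
      also have "\<dots> \<le> norm (u - w) + norm (u' + w)"
        using norm_triangle_ineq[of "u - w" "u' + w"] by simp
      finally show ?thesis by simp
    qed
    define c where "c = Sup S"
    have "S \<noteq> {}"
      using vM by (auto simp: S_def)
    have c_upper: "c \<le> norm (u' + w) - r'" if "(u', r') \<in> M" for u' r'
      unfolding c_def using \<open>S \<noteq> {}\<close> bound[OF _ that] by (intro cSup_least) (auto simp: S_def)
    have "bdd_above S"
      using bound[OF _ vM] by (intro bdd_aboveI) (auto simp: S_def)
    then have c_lower: "r - norm (u - w) \<le> c" if "(u, r) \<in> M" for u r
      unfolding c_def using that by (intro cSup_upper) (auto simp: S_def)
    \<comment> \<open>Dividing by the absolute value of \<open>t\<close> reduces the claim to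
      \<open>c_upper\<close> for positive and \<open>c_lower\<close> for negative
      \<open>t\<close>.\<close>
    have ineq: "r + t * c \<le> norm (u + t *\<^sub>R w)" if ur: "(u, r) \<in> M" for u r t
    proof (cases t "0 :: real" rule: linorder_cases)
      case less
      have "(1 / - t) * r - norm ((1 / - t) *\<^sub>R u - w) \<le> c"
        by (rule c_lower[OF scale[OF ur]])
      then have "(- t) * ((1 / - t) * r - norm ((1 / - t) *\<^sub>R u - w)) \<le> (- t) * c"
        using less by (intro mult_left_mono) auto
      moreover have "(- t) *\<^sub>R ((1 / - t) *\<^sub>R u - w) = u + t *\<^sub>R w"
        using less by (simp add: scaleR_diff_right)
      then have "norm (u + t *\<^sub>R w) = (- t) * norm ((1 / - t) *\<^sub>R u - w)"
        using less by (metis abs_of_pos neg_0_less_iff_less norm_scaleR)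
      moreover have "(- t) * ((1 / - t) * r - norm ((1 / - t) *\<^sub>R u - w))
          = r - (- t) * norm ((1 / - t) *\<^sub>R u - w)"
        using less by (simp add: right_diff_distrib)
      ultimately show ?thesis
        by linarith
    next
      case equal
      then show ?thesis using le[OF ur] by simp
    next
      case greater
      have "c \<le> norm ((1 / t) *\<^sub>R u + w) - (1 / t) * r"
        by (rule c_upper[OF scale[OF ur]])
      then have "t * c \<le> t * (norm ((1 / t) *\<^sub>R u + w) - (1 / t) * r)"
        using greater by (intro mult_left_mono) auto
      moreover have "t * norm ((1 / t) *\<^sub>R u + w) = norm (t *\<^sub>R ((1 / t) *\<^sub>R u + w))"
        using greater by simp
      moreover have "t *\<^sub>R ((1 / t) *\<^sub>R u + w) = u + t *\<^sub>R w"
        using greater by (simp add: scaleR_add_right)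
      ultimately show ?thesis
        using greater by (simp add: right_diff_distrib)
    qed
    let ?X = "span (insert (w, c) M)"
    have MX: "M \<subseteq> ?X"
      by (meson span_superset subset_insertI subset_trans)
    have "r \<le> norm u" if ur: "(u, r) \<in> ?X" for u r
    proof -
      obtain t where "(u, r) - t *\<^sub>R (w, c) \<in> span M"
        using ur unfolding span_insert by blast
      then have "(u - t *\<^sub>R w, r - t * c) \<in> M"
        using span_minimal[OF order_refl sub] by auto
      then show ?thesis
        using ineq[of "u - t *\<^sub>R w" "r - t * c" t] by simp
    qed
    then have "?X \<in> A"
      using vM MX by (auto simp: A_def)
    then have "?X = M"
      using max MX by blast
    then show ?thesis
      by (metis insertI1 span_base)
  qed
  have unique: "r = r'" if "(w, r) \<in> M" "(w, r') \<in> M" for w r r'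
  proof -
    have "(0, r - r') \<in> M" "(0, r' - r) \<in> M"
      using subspace_diff[OF sub that] subspace_diff[OF sub that(2) that(1)] by simp_all
    from this[THEN le] show ?thesis
      by simp
  qed
  define g where "g w = (THE r. (w, r) \<in> M)" for w
  have g_eq: "g w = r" if "(w, r) \<in> M" for w r
    unfolding g_def using that unique by blast
  have g: "(w, g w) \<in> M" for w
    using total g_eq by metis
  have "\<bar>g w\<bar> \<le> norm w" for w
    using le[OF g[of w]] le[OF scale[OF g[of w], of "- 1"]] by simp
  then have "bounded_linear g"
    by (intro bounded_linear_intro[where K = 1])
      (auto intro!: g_eq add scale g)
  moreover have "g v \<noteq> 0"
    using g_eq[OF vM] v by simp
  ultimately show ?thesis by blast
qed

section \<open>Complex scalars, complex functionals and the identity theorem\<close>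

interpretation scaleC: bounded_bilinear "(*\<^sub>C) :: complex \<Rightarrow> 'a \<Rightarrow> 'a::complex_unital_banach_algebra"
proof
  show "(r *\<^sub>R c) *\<^sub>C a = r *\<^sub>R (c *\<^sub>C a)" for r c and a :: 'a
    by (simp add: scaleR_conv_of_real scaleC_of_real flip: scaleC_scaleC)
  show "c *\<^sub>C (r *\<^sub>R a) = r *\<^sub>R (c *\<^sub>C a)" for r c and a :: 'a
    by (simp add: scaleC_scaleC mult.commute flip: scaleC_of_real)
  show "\<exists>K. \<forall>c (a :: 'a). norm (c *\<^sub>C a) \<le> norm c * norm a * K"
    by (intro exI[of _ 1]) (simp add: norm_scaleC)
qed (simp_all add: scaleC_add_left scaleC_add_right)

lemma scaleC_one [simp]: "1 *\<^sub>C a = a"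
  using scaleC_of_real[of 1 a] by simp

lemma scaleC_one_mult: "(c *\<^sub>C 1) * a = c *\<^sub>C a" "a * (c *\<^sub>C 1) = c *\<^sub>C a"
  by (simp_all add: mult_scaleC_left mult_scaleC_right)

lemma scaleC_power: "(c *\<^sub>C a) ^ n = c ^ n *\<^sub>C a ^ n"
  by (induction n) (simp_all add: mult_scaleC_left mult_scaleC_right scaleC_scaleC mult.commute)

lemma exists_complex_functional:
  fixes v :: "'a::complex_unital_banach_algebra"
  assumes "v \<noteq> 0"
  obtains \<psi> :: "'a \<Rightarrow> complex"
  where "bounded_linear \<psi>" "\<And>c a. \<psi> (c *\<^sub>C a) = c * \<psi> a" "\<psi> v \<noteq> 0"
proof -
  obtain g :: "'a \<Rightarrow> real" where g: "bounded_linear g" "g v \<noteq> 0"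
    using exists_bounded_linear_nonzero[OF assms] by blast
  interpret g: bounded_linear g by (rule g(1))
  \<comment> \<open>The usual complexification: the complex-linear functional with real part
    \<open>g\<close>.\<close>
  define \<psi> where "\<psi> a = complex_of_real (g a) - \<i> * complex_of_real (g (\<i> *\<^sub>C a))" for a
  have "bounded_linear \<psi>"
    unfolding \<psi>_def
    by (intro bounded_linear_sub bounded_linear_const_mult
        bounded_linear_compose[OF bounded_linear_of_real] g(1)
        bounded_linear_compose[OF g(1)] scaleC.bounded_linear_right)
  moreover have "\<psi> (c *\<^sub>C a) = c * \<psi> a" for c a
  proof -
    have c: "c *\<^sub>C a = Re c *\<^sub>R a + Im c *\<^sub>R (\<i> *\<^sub>C a)" for a :: 'a
    proof -
      have "c *\<^sub>C a = (complex_of_real (Re c) + complex_of_real (Im c) * \<i>) *\<^sub>C a"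
        by (metis complex_eq mult.commute)
      then show ?thesis
        by (simp only: scaleC_add_left scaleC_of_real flip: scaleC_scaleC)
    qed
    have "\<i> *\<^sub>C (\<i> *\<^sub>C a) = - a"
      using scaleC.minus_left[of 1 a] by (simp add: scaleC_scaleC)
    moreover have "\<i> *\<^sub>C (c *\<^sub>C a) = c *\<^sub>C (\<i> *\<^sub>C a)"
      by (simp add: scaleC_scaleC mult.commute)
    moreover have "g (c *\<^sub>C a) = Re c * g a + Im c * g (\<i> *\<^sub>C a)" for a
      by (subst c) (simp add: g.add g.scaleR)
    ultimately show ?thesis
      by (simp add: \<psi>_def g.neg complex_eq_iff algebra_simps)
  qed
  moreover have "\<psi> v \<noteq> 0"
    using g(2) by (auto simp: \<psi>_def complex_eq_iff)
  ultimately show thesis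
    using that by blast
qed

text \<open>A complex-linear functional not vanishing at \<open>f z\<close> would turn
  \<open>f\<close> into a scalar holomorphic function that contradicts analytic continuation from
  \<open>S\<close>.\<close>

lemma holomorphic_valued_identity:
  fixes f :: "complex \<Rightarrow> 'a::complex_unital_banach_algebra"
  assumes f: "holomorphic_valued_on f U" and U: "open U" "connected U"
    and S: "open S" "S \<noteq> {}" "S \<subseteq> U" "\<And>\<mu>. \<mu> \<in> S \<Longrightarrow> f \<mu> = 0"
    and z: "z \<in> U"
  shows "f z = 0"
proof (rule ccontr)
  assume "f z \<noteq> 0"
  then obtain \<psi> :: "'a \<Rightarrow> complex" where
    \<psi>: "bounded_linear \<psi>" "\<And>c a. \<psi> (c *\<^sub>C a) = c * \<psi> a" "\<psi> (f z) \<noteq> 0"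
    using exists_complex_functional by blast
  interpret \<psi>: bounded_linear \<psi> by (rule \<psi>(1))
  have "(\<lambda>\<mu>. \<psi> (f \<mu>)) holomorphic_on U"
    unfolding holomorphic_on_def field_differentiable_def
  proof
    fix \<mu> assume "\<mu> \<in> U"
    then obtain d where "(f has_derivative (\<lambda>h. h *\<^sub>C d)) (at \<mu> within U)"
      using f unfolding holomorphic_valued_on_def by blast
    then have "((\<lambda>\<mu>. \<psi> (f \<mu>)) has_derivative (\<lambda>h. \<psi> d * h)) (at \<mu> within U)"
      using \<psi>.has_derivative by (fastforce simp: \<psi>(2) mult.commute)
    then show "\<exists>D. ((\<lambda>\<mu>. \<psi> (f \<mu>)) has_field_derivative D) (at \<mu> within U)"
      unfolding has_field_derivative_def by blast
  qed
  then have "\<psi> (f z) = 0"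
    using analytic_continuation_open[of S U "\<lambda>\<mu>. \<psi> (f \<mu>)" "\<lambda>_. 0" z] U S z
    by (simp add: \<psi>.zero)
  with \<psi>(3) show False by simp
qed

section \<open>Neumann series\<close>

text \<open>The factor \<open>norm 1\<close> accounts for the exponent 0, as the norm of the unit
  may exceed 1.\<close>

lemma norm_power_le:
  fixes s :: "'a::{real_normed_algebra, ring_1}"
  shows "norm (s ^ n) \<le> norm (1 :: 'a) * norm s ^ n"
proof (induction n)
  case (Suc n)
  have "norm (s ^ Suc n) \<le> norm s * norm (s ^ n)"
    by (simp add: norm_mult_ineq)
  also have "\<dots> \<le> norm s * (norm (1 :: 'a) * norm s ^ n)"
    by (intro mult_left_mono Suc) simp
  finally show ?case by (simp add: mult_ac)
qed simp

lemma Neumann_series: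
  fixes t :: "'a::{real_normed_algebra, ring_1, banach}"
  assumes t: "norm t < 1"
  shows "summable (\<lambda>n. t ^ n)"
    and "(1 - t) * (\<Sum>n. t ^ n) = 1" "(\<Sum>n. t ^ n) * (1 - t) = 1"
    and "norm (\<Sum>n. t ^ n) \<le> norm (1 :: 'a) / (1 - norm t)"
proof -
  have geometric: "(\<lambda>n. norm (1 :: 'a) * norm t ^ n) sums (norm (1 :: 'a) * (1 / (1 - norm t)))"
    using t by (intro sums_mult geometric_sums) simp
  then have summable_norms: "summable (\<lambda>n. norm (t ^ n))"
    by (intro summable_comparison_test[OF _ sums_summable[OF geometric]])
      (auto intro: norm_power_le)
  then show summable: "summable (\<lambda>n. t ^ n)"
    by (rule summable_norm_cancel)
  have "(\<Sum>n. t ^ n) = 1 + (\<Sum>n. t ^ Suc n)"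
    using suminf_split_head[OF summable] by simp
  then have split: "(\<Sum>n. t ^ n) = 1 + t * (\<Sum>n. t ^ n)" "(\<Sum>n. t ^ n) = 1 + (\<Sum>n. t ^ n) * t"
    using suminf_mult[OF summable, of t] suminf_mult2[OF summable, of t]
    by (simp_all add: power_commutes)
  show "(1 - t) * (\<Sum>n. t ^ n) = 1" "(\<Sum>n. t ^ n) * (1 - t) = 1"
    using split by (simp_all add: algebra_simps)
  have "norm (\<Sum>n. t ^ n) \<le> (\<Sum>n. norm (t ^ n))"
    by (rule summable_norm[OF summable_norms])
  also have "\<dots> \<le> (\<Sum>n. norm (1 :: 'a) * norm t ^ n)"
    by (intro suminf_le norm_power_le summable_norms sums_summable[OF geometric])
  also have "\<dots> = norm (1 :: 'a) / (1 - norm t)"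
    using sums_unique[OF geometric] by simp
  finally show "norm (\<Sum>n. t ^ n) \<le> norm (1 :: 'a) / (1 - norm t)" .
qed

text \<open>The resolvent identity replaces termwise differentiation: it identifies the derivative
  as \<open>v * (G \<mu> * s * G \<mu>)\<close> and, applied twice, shows the error to be quadratic
  in \<open>\<nu> - \<mu>\<close>.\<close>

lemma holomorphic_valued_on_resolvent:
  fixes s v :: "'a::complex_unital_banach_algebra"
  assumes \<epsilon>: "\<epsilon> * norm s \<le> 1 / 2"
  shows "holomorphic_valued_on (\<lambda>\<mu>. v * (\<Sum>n. ((\<mu> - l) *\<^sub>C s) ^ n)) (ball l \<epsilon>)"
  unfolding holomorphic_valued_on_def
proof
  define G where "G \<mu> = (\<Sum>n. ((\<mu> - l) *\<^sub>C s) ^ n)" for \<mu>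
  define B where "B = norm (1 :: 'a) * 2"
  have small: "norm ((\<mu> - l) *\<^sub>C s) \<le> 1 / 2" if "\<mu> \<in> ball l \<epsilon>" for \<mu>
  proof -
    have "norm ((\<mu> - l) *\<^sub>C s) \<le> \<epsilon> * norm s"
      using that by (auto simp: norm_scaleC dist_norm norm_minus_commute intro!: mult_right_mono)
    then show ?thesis using \<epsilon> by simp
  qed
  have G: "(1 - (\<mu> - l) *\<^sub>C s) * G \<mu> = 1" "G \<mu> * (1 - (\<mu> - l) *\<^sub>C s) = 1" "norm (G \<mu>) \<le> B"
    if "\<mu> \<in> ball l \<epsilon>" for \<mu>
  proof -
    have *: "norm ((\<mu> - l) *\<^sub>C s) < 1"
      using small[OF that] by simp
    show "(1 - (\<mu> - l) *\<^sub>C s) * G \<mu> = 1" "G \<mu> * (1 - (\<mu> - l) *\<^sub>C s) = 1"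
      unfolding G_def by (rule Neumann_series[OF *])+
    have "norm (G \<mu>) \<le> norm (1 :: 'a) * (1 / (1 - norm ((\<mu> - l) *\<^sub>C s)))"
      using Neumann_series(4)[OF *] by (simp add: G_def)
    also have "\<dots> \<le> norm (1 :: 'a) * 2"
      using small[OF that] * by (intro mult_left_mono) (auto simp: field_simps)
    finally show "norm (G \<mu>) \<le> B" by (simp add: B_def)
  qed
  have B: "B \<ge> 0"
    by (simp add: B_def)
  fix \<mu> assume \<mu>: "\<mu> \<in> ball l \<epsilon>"
  have resolvent: "G \<nu> - G \<kappa> = (\<nu> - \<kappa>) *\<^sub>C (G \<kappa> * s * G \<nu>)"
    if "\<nu> \<in> ball l \<epsilon>" "\<kappa> \<in> ball l \<epsilon>" for \<nu> \<kappa>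
  proof -
    have "G \<kappa> * ((1 - (\<kappa> - l) *\<^sub>C s) - (1 - (\<nu> - l) *\<^sub>C s)) * G \<nu>
      = (G \<kappa> * (1 - (\<kappa> - l) *\<^sub>C s)) * G \<nu> - G \<kappa> * ((1 - (\<nu> - l) *\<^sub>C s) * G \<nu>)"
      by (simp only: right_diff_distrib left_diff_distrib mult.assoc)
    also have "\<dots> = G \<nu> - G \<kappa>"
      using G that by simp
    also have "(1 - (\<kappa> - l) *\<^sub>C s) - (1 - (\<nu> - l) *\<^sub>C s) = (\<nu> - \<kappa>) *\<^sub>C s"
      by (simp add: scaleC.diff_left)
    finally show ?thesis
      by (simp add: mult_scaleC_left mult_scaleC_right)
  qed
  define d where "d = v * (G \<mu> * s * G \<mu>)"
  \<comment> \<open>Bounds the coefficient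
    \<open>v * (G \<mu> * s * (G \<mu> * s * G \<nu>))\<close> of the quadratic error, uniformly in
    \<open>\<nu>\<close>.\<close>
  define K where "K = norm v * (B * norm s * (B * norm s * B))"
  have "((\<lambda>\<mu>. v * G \<mu>) has_derivative (\<lambda>h. h *\<^sub>C d)) (at \<mu> within ball l \<epsilon>)"
  proof (rule has_derivativeI_sandwich[of 1])
    show "bounded_linear (\<lambda>h. h *\<^sub>C d)"
      by (rule scaleC.bounded_linear_left)
    show "((\<lambda>\<nu>. K * norm (\<nu> - \<mu>)) \<longlongrightarrow> 0) (at \<mu> within ball l \<epsilon>)"
      by (rule tendsto_eq_intros | simp)+
    fix \<nu> assume \<nu>: "\<nu> \<in> ball l \<epsilon>" "\<nu> \<noteq> \<mu>"
    have "v * G \<nu> - v * G \<mu> - (\<nu> - \<mu>) *\<^sub>C d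
      = v * ((G \<nu> - G \<mu>) - (\<nu> - \<mu>) *\<^sub>C (G \<mu> * s * G \<mu>))"
      by (simp add: d_def right_diff_distrib mult_scaleC_right)
    also have "(G \<nu> - G \<mu>) - (\<nu> - \<mu>) *\<^sub>C (G \<mu> * s * G \<mu>) = (\<nu> - \<mu>) *\<^sub>C (G \<mu> * s * (G \<nu> - G \<mu>))"
      by (subst resolvent[OF \<nu>(1) \<mu>]) (simp only: scaleC.diff_right right_diff_distrib)
    also have "G \<nu> - G \<mu> = (\<nu> - \<mu>) *\<^sub>C (G \<mu> * s * G \<nu>)"
      by (rule resolvent[OF \<nu>(1) \<mu>])
    finally have "norm (v * G \<nu> - v * G \<mu> - (\<nu> - \<mu>) *\<^sub>C d)
      = norm (\<nu> - \<mu>) * (norm (\<nu> - \<mu>) * norm (v * (G \<mu> * s * (G \<mu> * s * G \<nu>))))"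
      by (simp add: mult_scaleC_right norm_scaleC)
    also have "norm (v * (G \<mu> * s * (G \<mu> * s * G \<nu>))) \<le> K"
      unfolding K_def
      by (intro norm_mult_ineq[THEN order_trans] mult_mono mult_nonneg_nonneg G \<mu> \<nu> B) auto
    finally show "norm ((v * G \<nu> - v * G \<mu>) - (\<nu> - \<mu>) *\<^sub>C d) / norm (\<nu> - \<mu>) \<le> K * norm (\<nu> - \<mu>)"
      using \<nu>(2) by (simp add: mult_left_mono field_simps)
  qed simp
  then show "\<exists>d. ((\<lambda>\<mu>. v * (\<Sum>n. ((\<mu> - l) *\<^sub>C s) ^ n)) has_derivative (\<lambda>h. h *\<^sub>C d)) (at \<mu> within ball l \<epsilon>)"
    unfolding G_def by blast
qed

lemma right_invertible_perturb:
  fixes a b :: "'a::complex_unital_banach_algebra"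
  assumes "a * b = 1" "cmod c * norm b < 1"
  shows "right_invertible (a - c *\<^sub>C 1)"
proof -
  have "norm (c *\<^sub>C b) < 1"
    using assms by (simp add: norm_scaleC)
  then have "(1 - c *\<^sub>C b) * (\<Sum>n. (c *\<^sub>C b) ^ n) = 1"
    by (rule Neumann_series)
  moreover have "(a - c *\<^sub>C 1) * b = 1 - c *\<^sub>C b"
    by (simp add: left_diff_distrib assms(1) scaleC_one_mult)
  ultimately have "(a - c *\<^sub>C 1) * (b * (\<Sum>n. (c *\<^sub>C b) ^ n)) = 1"
    by (simp flip: mult.assoc)
  then show ?thesis
    unfolding right_invertible_def by blast
qed

text \<open>Every neighbourhood \<open>U\<close> contains a point \<open>\<mu>\<close> where
  \<open>x - \<mu>\<close> has a right inverse. Right invertibility persists on a small disc, where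
  cancelling with the right inverse gives \<open>f = 0\<close>; the identity theorem spreads this
  over \<open>U\<close>.\<close>

lemma right_SVEP_if_not_interior:
  fixes x :: "'a::complex_unital_banach_algebra"
  assumes "l \<notin> interior (right_spectrum x)"
  shows "right_SVEP x l"
  unfolding right_SVEP_def
proof (intro allI impI ballI)
  fix U f z
  assume U: "open U \<and> connected U \<and> l \<in> U"
    and f: "holomorphic_valued_on f U \<and> (\<forall>\<mu>\<in>U. f \<mu> * (\<mu> *\<^sub>C 1 - x) = 0)"
    and z: "z \<in> U"
  have "\<not> U \<subseteq> right_spectrum x"
    using U assms interior_maximal by blast
  then obtain \<mu> where \<mu>: "\<mu> \<in> U" "\<mu> \<notin> right_spectrum x"
    by blast
  then obtain b where b: "(x - \<mu> *\<^sub>C 1) * b = 1"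
    by (auto simp: right_spectrum_def right_invertible_def)
  define \<epsilon> where "\<epsilon> = 1 / (norm b + 1)"
  have \<epsilon>: "\<epsilon> > 0"
    by (simp add: \<epsilon>_def add_nonneg_pos)
  have vanish: "f \<nu> = 0" if "\<nu> \<in> ball \<mu> \<epsilon> \<inter> U" for \<nu>
  proof -
    have "cmod (\<nu> - \<mu>) * norm b \<le> \<epsilon> * norm b"
      using that by (intro mult_right_mono) (auto simp: dist_norm norm_minus_commute)
    also have "\<dots> < 1"
      by (simp add: \<epsilon>_def) (simp add: divide_less_eq_1 add_nonneg_pos)
    finally have "right_invertible (x - \<mu> *\<^sub>C 1 - (\<nu> - \<mu>) *\<^sub>C 1)"
      by (rule right_invertible_perturb[OF b])
    then obtain c where c: "(x - \<nu> *\<^sub>C 1) * c = 1"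
      by (auto simp: right_invertible_def scaleC.diff_left)
    have "f \<nu> * (\<nu> *\<^sub>C 1 - x) = 0"
      using f that by blast
    then have "f \<nu> * (x - \<nu> *\<^sub>C 1) = 0"
      by (simp add: right_diff_distrib)
    then have "f \<nu> * ((x - \<nu> *\<^sub>C 1) * c) = 0"
      by (simp flip: mult.assoc)
    then show ?thesis
      by (simp add: c)
  qed
  show "f z = 0"
  proof (rule holomorphic_valued_identity[where U = U])
    show "open (ball \<mu> \<epsilon> \<inter> U)"
      using U by (intro open_Int) auto
    show "ball \<mu> \<epsilon> \<inter> U \<noteq> {}"
      using \<mu> \<epsilon> centre_in_ball by blast
  qed (use f U z vanish in blast)+
qed

section \<open>The right quasinilpotent part\<close>

lemma right_quasinilpotent_partD:
  assumes "a \<in> right_quasinilpotent_part y" "\<epsilon> > 0"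
  shows "\<forall>\<^sub>F n in sequentially. norm (a * y ^ n) \<le> \<epsilon> ^ n"
proof -
  have "(\<lambda>n. root n (norm (a * y ^ n))) \<longlonglongrightarrow> 0"
    using assms(1) by (simp add: right_quasinilpotent_part_def)
  then have "\<forall>\<^sub>F n in sequentially. root n (norm (a * y ^ n)) < \<epsilon>"
    using assms(2) order_tendstoD(2) by blast
  with eventually_gt_at_top[of 0] show ?thesis
  proof eventually_elim
    case (elim n)
    have "norm (a * y ^ n) = root n (norm (a * y ^ n)) ^ n"
      using elim by simp
    also have "\<dots> \<le> \<epsilon> ^ n"
      using elim by (intro power_mono) auto
    finally show ?case .
  qed
qed

text \<open>Here \<open>norm (a * y ^ n)\<close> is \<open>cmod c ^ n * norm a\<close>, which for
  \<open>a \<noteq> 0\<close> eventually exceeds \<open>(cmod c / 2) ^ n\<close>.\<close>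

lemma right_quasinilpotent_part_eigenvector:
  fixes y :: "'a::complex_unital_banach_algebra"
  assumes a: "a \<in> right_quasinilpotent_part y" and eigen: "a * y = c *\<^sub>C a" and c: "c \<noteq> 0"
  shows "a = 0"
proof -
  have power: "a * y ^ n = c ^ n *\<^sub>C a" for n
  proof (induction n)
    case (Suc n)
    have "a * y ^ Suc n = c ^ n *\<^sub>C a * y"
      using Suc by (simp add: power_Suc2 del: power_Suc flip: mult.assoc)
    then show ?case
      by (simp add: mult_scaleC_left eigen scaleC_scaleC mult.commute)
  qed simp
  have "\<forall>\<^sub>F n in sequentially. norm (a * y ^ n) \<le> (cmod c / 2) ^ n"
    using c by (intro right_quasinilpotent_partD[OF a]) simp
  then have "\<forall>\<^sub>F n in sequentially. norm a \<le> (1 / 2) ^ n"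
  proof eventually_elim
    case (elim n)
    then have "cmod c ^ n * norm a \<le> cmod c ^ n * (1 / 2) ^ n"
      by (simp add: power norm_scaleC norm_power power_divide)
    then show ?case
      using c by (simp add: mult_le_cancel_left)
  qed
  moreover have "(\<lambda>n. (1 / 2 :: real) ^ n) \<longlonglongrightarrow> 0"
    by (rule LIMSEQ_power_zero) simp
  ultimately have "norm a \<le> 0"
    by (intro tendsto_lowerbound[of _ 0 sequentially]) auto
  then show ?thesis by simp
qed

lemma left_annihilator_subset_quasinilpotent_part:
  "left_annihilator (y ^ p) \<subseteq> right_quasinilpotent_part y"
proof
  fix a assume a: "a \<in> left_annihilator (y ^ p)"
  have "\<forall>\<^sub>F n in sequentially. root n (norm (a * y ^ n)) = 0"
    using eventually_ge_at_top[of p]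
  proof eventually_elim
    case (elim n)
    then have "a * y ^ n = 0"
      using a left_annihilator_power_mono[of p n y] by (auto simp: left_annihilator_def)
    then show ?case by simp
  qed
  then show "a \<in> right_quasinilpotent_part y"
    unfolding right_quasinilpotent_part_def by (simp add: tendsto_eventually)
qed

text \<open>In \<open>a * y ^ n = a * y ^ (n + j) * c ^ j\<close> the first factor decays faster
  than any geometric sequence in \<open>j\<close>, which beats the growth of
  \<open>c ^ j\<close>.\<close>

lemma quasinilpotent_part_subset_if_descends:
  fixes y :: "'a::complex_unital_banach_algebra"
  assumes c: "y ^ n = y ^ Suc n * c"
  shows "right_quasinilpotent_part y \<subseteq> left_annihilator (y ^ n)"
proof
  fix a assume a: "a \<in> right_quasinilpotent_part y"
  define \<epsilon> where "\<epsilon> = 1 / (2 * (norm c + 1))"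
  have \<epsilon>: "\<epsilon> > 0"
    by (simp add: \<epsilon>_def add_nonneg_pos)
  have \<epsilon>c: "\<epsilon> * norm c \<le> 1 / 2"
    by (simp add: \<epsilon>_def divide_simps add_nonneg_pos add_nonneg_eq_0_iff)
  have "\<forall>\<^sub>F j in sequentially. norm (a * y ^ j) \<le> \<epsilon> ^ j"
    by (rule right_quasinilpotent_partD[OF a \<epsilon>])
  then have "\<forall>\<^sub>F j in sequentially. norm (a * y ^ (j + n)) \<le> \<epsilon> ^ (j + n)"
    using eventually_sequentially_seg[of "\<lambda>j. norm (a * y ^ j) \<le> \<epsilon> ^ j" n] by simp
  then have "\<forall>\<^sub>F j in sequentially. norm (a * y ^ n) \<le> \<epsilon> ^ n * norm (1 :: 'a) * (1 / 2) ^ j"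
  proof eventually_elim
    case (elim j)
    have "a * y ^ n = a * y ^ (j + n) * c ^ j"
      using descends_iterate[OF c, of j] by (simp add: mult.assoc add.commute)
    then have "norm (a * y ^ n) \<le> norm (a * y ^ (j + n)) * norm (c ^ j)"
      by (metis norm_mult_ineq)
    also have "\<dots> \<le> \<epsilon> ^ (j + n) * (norm (1 :: 'a) * norm c ^ j)"
      using \<epsilon> by (intro mult_mono elim norm_power_le) auto
    also have "\<dots> = \<epsilon> ^ n * norm (1 :: 'a) * (\<epsilon> * norm c) ^ j"
      by (simp add: power_add power_mult_distrib mult_ac)
    also have "\<dots> \<le> \<epsilon> ^ n * norm (1 :: 'a) * (1 / 2) ^ j"
      using \<epsilon> \<epsilon>c by (intro mult_left_mono power_mono) auto
    finally show ?case .
  qed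
  moreover have "(\<lambda>j. \<epsilon> ^ n * norm (1 :: 'a) * (1 / 2) ^ j) \<longlonglongrightarrow> \<epsilon> ^ n * norm (1 :: 'a) * 0"
    by (intro tendsto_intros LIMSEQ_power_zero) simp
  ultimately have "norm (a * y ^ n) \<le> \<epsilon> ^ n * norm (1 :: 'a) * 0"
    by (intro tendsto_lowerbound[of _ _ sequentially]) auto
  then show "a \<in> left_annihilator (y ^ n)"
    by (simp add: left_annihilator_def)
qed

text \<open>Since \<open>(y - l) * (y ^ n * c) = y ^ n * (1 - l * c)\<close>, small \<open>l\<close>
  make \<open>y ^ n\<close> a right multiple of \<open>y - l\<close>. So is
  \<open>y ^ n - l ^ n\<close>, hence also the scalar \<open>l ^ n\<close>, which is invertible for
  \<open>l \<noteq> 0\<close>.\<close>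

lemma right_invertible_near_if_descends:
  fixes y :: "'a::complex_unital_banach_algebra"
  assumes c: "y ^ n = y ^ Suc n * c" and l: "l \<noteq> 0" "cmod l * norm c < 1"
  shows "right_invertible (y - l *\<^sub>C 1)"
proof -
  define G where "G = (\<Sum>n. (l *\<^sub>C c) ^ n)"
  have G: "(1 - l *\<^sub>C c) * G = 1"
    unfolding G_def using l by (intro Neumann_series) (simp add: norm_scaleC)
  have "(y - l *\<^sub>C 1) * (y ^ n * c * G) = (y ^ Suc n * c - l *\<^sub>C (y ^ n * c)) * G"
    by (simp add: left_diff_distrib scaleC_one_mult mult_scaleC_left mult.assoc)
  also have "\<dots> = y ^ n * ((1 - l *\<^sub>C c) * G)"
    by (simp only: c[symmetric]) (simp add: left_diff_distrib right_diff_distrib mult_scaleC_right mult_scaleC_left mult.assoc)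
  finally have 1: "(y - l *\<^sub>C 1) * (y ^ n * c * G) = y ^ n"
    by (simp add: G)
  have "\<exists>q. y ^ n - l ^ n *\<^sub>C 1 = (y - l *\<^sub>C 1) * q" for n
  proof (induction n)
    case (Suc n)
    then obtain q where q: "y ^ n - l ^ n *\<^sub>C 1 = (y - l *\<^sub>C 1) * q" ..
    have "y ^ Suc n - l ^ Suc n *\<^sub>C 1 = (y - l *\<^sub>C 1) * y ^ n + l *\<^sub>C (y ^ n - l ^ n *\<^sub>C 1)"
      by (simp add: left_diff_distrib scaleC_one_mult scaleC.diff_right scaleC_scaleC)
    also have "\<dots> = (y - l *\<^sub>C 1) * (y ^ n + l *\<^sub>C q)"
      by (simp add: q distrib_left mult_scaleC_right)
    finally show ?case ..
  qed (auto intro: exI[of _ 0])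
  then obtain q where "y ^ n - l ^ n *\<^sub>C 1 = (y - l *\<^sub>C 1) * q"
    by blast
  then have "(y - l *\<^sub>C 1) * (y ^ n * c * G - q) = l ^ n *\<^sub>C 1"
    by (simp only: right_diff_distrib 1) (simp add: algebra_simps)
  then have "(y - l *\<^sub>C 1) * (inverse (l ^ n) *\<^sub>C (y ^ n * c * G - q)) = 1"
    using l by (simp add: mult_scaleC_right scaleC_scaleC)
  then show ?thesis
    unfolding right_invertible_def by blast
qed

section \<open>Failure of the single-valued extension property\<close>

text \<open>The iterates \<open>w * s ^ n\<close> form a backward orbit of \<open>w\<close>, growing
  at most like powers of \<open>norm s + 1\<close>, where the summand 1 keeps the constant
  positive.\<close>

lemma hyperrange_subset_analytical_core:
  fixes y :: "'a::complex_unital_banach_algebra"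
  assumes s: "\<And>w. w \<in> hyperrange y \<Longrightarrow> w * s \<in> hyperrange y"
    and lift: "\<And>w. w \<in> hyperrange y \<Longrightarrow> w * s * y = w"
  shows "hyperrange y \<subseteq> right_analytical_core y"
proof
  fix w assume w: "w \<in> hyperrange y"
  have mem: "w * s ^ n \<in> hyperrange y" for n
  proof (induction n)
    case (Suc n)
    then show ?case
      using s[OF Suc] by (simp add: mult.assoc power_Suc2 del: power_Suc)
  qed (simp add: w)
  have "w * s ^ Suc n * y = w * s ^ n" for n
    using lift[OF mem[of n]] by (simp add: mult.assoc power_Suc2 del: power_Suc)
  moreover have "norm (w * s ^ n) \<le> (norm s + 1) ^ n * norm w" for n
  proof (induction n)
    case (Suc n)
    have "norm (w * s ^ Suc n) \<le> norm (w * s ^ n) * norm s"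
      using norm_mult_ineq[of "w * s ^ n" s] by (simp add: mult.assoc power_Suc2 del: power_Suc)
    also have "\<dots> \<le> (norm s + 1) ^ n * norm w * (norm s + 1)"
      by (intro mult_mono Suc) auto
    finally show ?case by (simp add: mult_ac)
  qed simp
  moreover have "w * s ^ 1 * y = w"
    using lift[OF w] by simp
  ultimately show "w \<in> right_analytical_core y"
    unfolding right_analytical_core_def
    by (intro CollectI exI[of _ "\<lambda>n. w * s ^ n"] exI[of _ "norm s + 1"])
      (simp del: power_Suc add: add_nonneg_pos)
qed

text \<open>If \<open>v y = 0\<close> and \<open>v\<close> lies in the hyperrange, iterating the lift \<open>s\<close> produces the
  eigenvectors \<open>\<Sum>n. \<lambda>^n (v s^n)\<close> of \<open>R\<^sub>y\<close>, which depend holomorphically on \<open>\<lambda>\<close>.\<close>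

lemma hyperrange_eigenvectors:
  fixes y :: "'a::complex_unital_banach_algebra"
  assumes sp: "semiprime TYPE('a)" and y: "B_Fredholm y"
    and v: "v \<in> left_annihilator y" "v \<in> hyperrange y"
  shows "\<exists>\<epsilon> f. \<epsilon> > 0 \<and> holomorphic_valued_on (\<lambda>\<mu>. f (\<mu> - l)) (ball l \<epsilon>) \<and> f 0 = v \<and>
    (\<forall>\<mu>. cmod \<mu> < \<epsilon> \<longrightarrow> f \<mu> * y = \<mu> *\<^sub>C f \<mu> \<and>
      f \<mu> \<in> closure (right_quasinilpotent_part y \<inter> right_analytical_core y))"
proof -
  obtain s where s: "\<And>w. w \<in> hyperrange y \<Longrightarrow> w * s \<in> hyperrange y"
    and lift: "\<And>w. w \<in> hyperrange y \<Longrightarrow> w * s * y = w"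
    using hyperrange_lift[OF sp y] by blast
  define \<epsilon> where "\<epsilon> = 1 / (2 * (norm s + 1))"
  have \<epsilon>: "\<epsilon> > 0"
    by (simp add: \<epsilon>_def add_nonneg_pos)
  have \<epsilon>s: "\<epsilon> * norm s \<le> 1 / 2"
    by (simp add: \<epsilon>_def divide_simps add_nonneg_pos add_nonneg_eq_0_iff)
  define f where "f \<mu> = v * (\<Sum>n. (\<mu> *\<^sub>C s) ^ n)" for \<mu>
  \<comment> \<open>The partial sums lie in the hyperrange and are annihilated by
    \<open>y ^ m\<close>, hence belong to the analytical core and to the quasinilpotent part. This
    puts the limit \<open>f \<mu>\<close> into the closure of the intersection.\<close>
  define P where "P \<mu> m = v * (\<Sum>n<m. (\<mu> *\<^sub>C s) ^ n)" for \<mu> m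
  have mem: "v * s ^ n \<in> hyperrange y" for n
  proof (induction n)
    case (Suc n)
    then show ?case
      using s[OF Suc] by (simp add: mult.assoc power_Suc2 del: power_Suc)
  qed (simp add: v)
  have P_Suc: "P \<mu> (Suc m) = P \<mu> m + \<mu> ^ m *\<^sub>C (v * s ^ m)" for \<mu> m
    by (simp add: P_def distrib_left scaleC_power mult_scaleC_right)
  \<comment> \<open>Multiplication by \<open>y\<close> kills the term \<open>v\<close> and turns
    \<open>v * s ^ Suc n\<close> into \<open>v * s ^ n\<close>, so the sum loses one term and gains
    a factor \<open>\<mu>\<close>.\<close>
  have P_eigen: "P \<mu> (Suc m) * y = \<mu> *\<^sub>C P \<mu> m" for \<mu> m
  proof (induction m)
    case 0
    then show ?case
      using v by (simp add: P_def left_annihilator_def scaleC.zero_right)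
  next
    case (Suc m)
    have "v * s ^ Suc m * y = v * s ^ m"
      using lift[OF mem[of m]] by (simp add: mult.assoc power_Suc2 del: power_Suc)
    then have "P \<mu> (Suc (Suc m)) * y = P \<mu> (Suc m) * y + \<mu> ^ Suc m *\<^sub>C (v * s ^ m)"
      by (simp only: P_Suc[of _ "Suc m"] distrib_right mult_scaleC_left)
    then show ?case
      by (simp only: Suc) (simp add: P_Suc scaleC.add_right scaleC_scaleC)
  qed
  have P_hyperrange: "P \<mu> m \<in> hyperrange y" for \<mu> m
  proof (induction m)
    case 0
    then show ?case
      by (simp add: P_def zero_in_hyperrange)
  next
    case (Suc m)
    have "(\<mu> ^ m *\<^sub>C 1) * (v * s ^ m) \<in> hyperrange y"
      using mem left_ideal_hyperrange[of y] unfolding left_ideal_def by blast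
    then show ?case
      using Suc left_ideal_hyperrange[of y] unfolding P_Suc left_ideal_def scaleC_one_mult
      by blast
  qed
  have "P \<mu> m * y ^ m = 0" for \<mu> m
  proof (induction m)
    case (Suc m)
    have "P \<mu> (Suc m) * y ^ Suc m = \<mu> *\<^sub>C (P \<mu> m * y ^ m)"
      by (simp add: P_eigen mult_scaleC_left flip: mult.assoc)
    then show ?case
      by (simp add: Suc scaleC.zero_right)
  qed (simp add: P_def)
  then have P_quasinilpotent: "P \<mu> m \<in> right_quasinilpotent_part y" for \<mu> m
    using left_annihilator_subset_quasinilpotent_part[of y m] by (auto simp: left_annihilator_def)
  have P_limit: "P \<mu> \<longlonglongrightarrow> f \<mu>" if "cmod \<mu> < \<epsilon>" for \<mu>
  proof -
    have "cmod \<mu> * norm s \<le> \<epsilon> * norm s"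
      using that by (intro mult_right_mono) auto
    then have "norm (\<mu> *\<^sub>C s) < 1"
      using \<epsilon>s by (simp add: norm_scaleC)
    then have "(\<lambda>m. \<Sum>n<m. (\<mu> *\<^sub>C s) ^ n) \<longlonglongrightarrow> (\<Sum>n. (\<mu> *\<^sub>C s) ^ n)"
      by (intro summable_LIMSEQ Neumann_series)
    then show ?thesis
      unfolding P_def f_def by (intro tendsto_mult tendsto_const)
  qed
  show ?thesis
  proof (intro exI[of _ \<epsilon>] exI[of _ f] conjI allI impI)
    show "\<epsilon> > 0" by (rule \<epsilon>)
    show "holomorphic_valued_on (\<lambda>\<mu>. f (\<mu> - l)) (ball l \<epsilon>)"
      unfolding f_def by (rule holomorphic_valued_on_resolvent[OF \<epsilon>s])
    have "(\<Sum>n. (0 *\<^sub>C s) ^ n) = (1 :: 'a)"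
      using Neumann_series(2)[of "0 :: 'a"] by (simp add: scaleC.zero_left)
    then show "f 0 = v"
      by (simp add: f_def)
  next
    fix \<mu> assume \<mu>: "cmod \<mu> < \<epsilon>"
    have "(\<lambda>m. P \<mu> (Suc m) * y) \<longlonglongrightarrow> f \<mu> * y"
      by (intro tendsto_mult tendsto_const LIMSEQ_Suc[OF P_limit[OF \<mu>]])
    moreover have "(\<lambda>m. \<mu> *\<^sub>C P \<mu> m) \<longlonglongrightarrow> \<mu> *\<^sub>C f \<mu>"
      by (intro scaleC.tendsto tendsto_const P_limit[OF \<mu>])
    ultimately show "f \<mu> * y = \<mu> *\<^sub>C f \<mu>"
      unfolding P_eigen by (rule LIMSEQ_unique)
    show "f \<mu> \<in> closure (right_quasinilpotent_part y \<inter> right_analytical_core y)"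
      unfolding closure_sequential
      using P_limit[OF \<mu>] P_quasinilpotent P_hyperrange
        hyperrange_subset_analytical_core[OF s lift] by blast
  qed
qed

lemma holomorphic_valued_on_imp_continuous_on:
  "holomorphic_valued_on f U \<Longrightarrow> continuous_on U f"
  unfolding holomorphic_valued_on_def continuous_on_eq_continuous_within
  using has_derivative_continuous by blast

text \<open>The set \<open>S\<close> is left open in order to treat the quasinilpotent part and its
  intersection with the core alike. Closedness puts the eigenvectors \<open>f \<mu>\<close> into the
  quasinilpotent part, so they vanish for \<open>\<mu> \<noteq> 0\<close>, and by continuity so does
  \<open>f 0 = v\<close>.\<close>

lemma left_annihilator_Int_hyperrange_if_closed:
  fixes y :: "'a::complex_unital_banach_algebra"
  assumes sp: "semiprime TYPE('a)" and y: "B_Fredholm y"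
    and S: "closed S" "right_quasinilpotent_part y \<inter> right_analytical_core y \<subseteq> S"
      "S \<subseteq> right_quasinilpotent_part y"
  shows "left_annihilator y \<inter> hyperrange y = {0}"
proof -
  have "v = 0" if v: "v \<in> left_annihilator y" "v \<in> hyperrange y" for v
  proof -
    obtain \<epsilon> f where \<epsilon>: "\<epsilon> > 0"
      and hol: "holomorphic_valued_on (\<lambda>\<mu>. f (\<mu> - 0)) (ball 0 \<epsilon>)"
      and f0: "f 0 = v" and eigen: "\<forall>\<mu>. cmod \<mu> < \<epsilon> \<longrightarrow> f \<mu> * y = \<mu> *\<^sub>C f \<mu> \<and>
        f \<mu> \<in> closure (right_quasinilpotent_part y \<inter> right_analytical_core y)"
      using hyperrange_eigenvectors[OF sp y v, of 0] by blast
    have zero: "f \<mu> = 0" if "\<mu> \<noteq> 0" "cmod \<mu> < \<epsilon>" for \<mu>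
    proof (rule right_quasinilpotent_part_eigenvector)
      show "f \<mu> \<in> right_quasinilpotent_part y"
        using eigen that(2) closure_minimal[OF S(2,1)] S(3) by blast
    qed (use that eigen in auto)
    have "continuous_on (ball 0 \<epsilon>) f"
      using holomorphic_valued_on_imp_continuous_on[OF hol] by simp
    then have "isCont f 0"
      using \<epsilon> by (simp add: continuous_on_eq_continuous_at)
    then have "f \<midarrow>0\<rightarrow> f 0"
      by (simp add: isCont_def)
    moreover have "\<forall>\<^sub>F \<mu> in at 0. f \<mu> = 0"
      unfolding eventually_at using \<epsilon> zero by (intro exI[of _ \<epsilon>]) simp
    then have "f \<midarrow>0\<rightarrow> 0"
      by (rule tendsto_eventually)
    ultimately show "v = 0"
      using f0 LIM_unique by blast
  qed
  then show ?thesis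
    using zero_in_hyperrange[of y] zero_in_left_annihilator[of y] by blast
qed

text \<open>As \<open>\<mu> - x = (\<mu> - l) - y\<close>, the translated eigenvectors
  \<open>f (\<mu> - l)\<close> solve the equation of the right SVEP near \<open>l\<close>. So they
  vanish, in particular at \<open>l\<close>, where the value is \<open>v\<close>.\<close>

lemma left_annihilator_Int_hyperrange_if_right_SVEP:
  fixes x :: "'a::complex_unital_banach_algebra"
  assumes sp: "semiprime TYPE('a)" and y: "B_Fredholm (x - l *\<^sub>C 1)" and svep: "right_SVEP x l"
  shows "left_annihilator (x - l *\<^sub>C 1) \<inter> hyperrange (x - l *\<^sub>C 1) = {0}"
proof -
  define y where "y = x - l *\<^sub>C 1"
  have "v = 0" if v: "v \<in> left_annihilator y" "v \<in> hyperrange y" for v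
  proof -
    obtain \<epsilon> f where \<epsilon>: "\<epsilon> > 0" and hol: "holomorphic_valued_on (\<lambda>\<mu>. f (\<mu> - l)) (ball l \<epsilon>)"
      and f0: "f 0 = v" and eigen: "\<forall>\<mu>. cmod \<mu> < \<epsilon> \<longrightarrow> f \<mu> * y = \<mu> *\<^sub>C f \<mu>"
      using hyperrange_eigenvectors[OF sp assms(2)[folded y_def] v, of l] by blast
    have "f (\<mu> - l) * (\<mu> *\<^sub>C 1 - x) = 0" if "\<mu> \<in> ball l \<epsilon>" for \<mu>
    proof -
      have "cmod (\<mu> - l) < \<epsilon>"
        using that by (simp add: dist_norm norm_minus_commute)
      have "\<mu> *\<^sub>C 1 - x = (\<mu> - l) *\<^sub>C 1 - y"
        by (simp add: y_def scaleC.diff_left)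
      then show ?thesis
        using eigen \<open>cmod (\<mu> - l) < \<epsilon>\<close> by (simp add: right_diff_distrib scaleC_one_mult)
    qed
    moreover have "open (ball l \<epsilon>) \<and> connected (ball l \<epsilon>) \<and> l \<in> ball l \<epsilon>"
      using \<epsilon> by simp
    ultimately have "\<forall>\<mu>\<in>ball l \<epsilon>. f (\<mu> - l) = 0"
      using svep hol unfolding right_SVEP_def by blast
    moreover have "l \<in> ball l \<epsilon>"
      using \<epsilon> by simp
    ultimately have "f (l - l) = 0"
      by (rule bspec)
    then show "v = 0"
      using f0 by simp
  qed
  then show ?thesis
    using zero_in_hyperrange[of y] zero_in_left_annihilator[of y] unfolding y_def by blast
qed

section \<open>Equivalence of the conditions\<close>

text \<open>Finite left descent is the hub: it implies each condition, each condition implies that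
  \<open>left_annihilator y\<close> meets the hyperrange trivially, and this gives back the
  descent.\<close>

lemma B_Fredholm_descends_iff:
  fixes y :: "'a::complex_unital_banach_algebra"
  assumes sp: "semiprime TYPE('a)" and y: "B_Fredholm y"
  defines "H \<equiv> right_quasinilpotent_part y" and "K \<equiv> right_analytical_core y"
  shows "left_descent y < \<infinity> \<longleftrightarrow> right_ascent y < \<infinity>"
    and "left_descent y < \<infinity> \<longleftrightarrow> (\<exists>p. H = left_annihilator (y ^ p))"
    and "left_descent y < \<infinity> \<longleftrightarrow> closed H"
    and "left_descent y < \<infinity> \<longleftrightarrow> H \<inter> K = {0}"
    and "left_descent y < \<infinity> \<longleftrightarrow> closed (H \<inter> K)"
    and "left_descent y < \<infinity> \<longleftrightarrow> hyperkernel y \<inter> hyperrange y = {0}"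
    and "left_descent y < \<infinity> \<longleftrightarrow> left_annihilator y \<inter> hyperrange y = {0}"
proof -
  let ?D = "left_descent y < \<infinity>" and ?N = "left_annihilator y \<inter> hyperrange y = {0}"
  have N_D: "?N \<Longrightarrow> ?D"
    unfolding left_descent_finite_iff by (rule power_descends[OF sp y])
  have D_ascent: "right_ascent y < \<infinity>" if ?D
    using that left_annihilator_stable_if_descends
    unfolding left_descent_finite_iff right_ascent_finite_iff by blast
  have ascent_kernel: "hyperkernel y \<inter> hyperrange y = {0}" if "right_ascent y < \<infinity>"
    using that hyperkernel_Int_hyperrange unfolding right_ascent_finite_iff by blast
  have kernel_N: "hyperkernel y \<inter> hyperrange y = {0} \<Longrightarrow> ?N"
    by (rule left_annihilator_Int_hyperrange)
  have D_H: "\<exists>p. H = left_annihilator (y ^ p)" if ?D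
    using that quasinilpotent_part_subset_if_descends left_annihilator_subset_quasinilpotent_part
    unfolding left_descent_finite_iff H_def by blast
  have closed_annihilator: "closed (left_annihilator z)" for z :: 'a
    unfolding left_annihilator_def by (intro closed_Collect_eq continuous_intros)
  then have H_closed: "closed H" if "\<exists>p. H = left_annihilator (y ^ p)"
    using that by auto
  have closed_N: "closed H \<Longrightarrow> ?N" "closed (H \<inter> K) \<Longrightarrow> ?N"
    using left_annihilator_Int_hyperrange_if_closed[OF sp y] unfolding H_def K_def by blast+
  have D_HK: "H \<inter> K = {0}" if ?D
  proof -
    obtain p where p: "H = left_annihilator (y ^ p)"
      using D_H \<open>?D\<close> by blast
    have "a = 0" if a: "a \<in> H" "a \<in> K" for a
    proof -
      obtain s \<delta> where s: "s 1 * y = a" "\<And>n. n \<ge> 1 \<Longrightarrow> s (Suc n) * y = s n"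
        using a(2) unfolding K_def right_analytical_core_def by blast
      \<comment> \<open>Unwinding the backward sequence puts elements of the analytical core into
        the hyperrange; the sequence is indexed from 1.\<close>
      have "s (Suc n) * y ^ Suc n = a" for n
      proof (induction n)
        case (Suc n)
        have "s (Suc (Suc n)) * y ^ Suc (Suc n) = s (Suc (Suc n)) * y * y ^ Suc n"
          by (simp add: mult.assoc)
        then show ?case
          using Suc s(2)[of "Suc n"] by simp
      qed (use s in simp)
      then have "a \<in> range (\<lambda>a. a * y ^ n)" for n
        using range_mult_power_antimono[of n "Suc n" y] by (metis le_add2 plus_1_eq_Suc rangeI subsetD)
      then have "a \<in> hyperrange y"
        by (simp add: hyperrange_def)
      \<comment> \<open>\<open>p\<close> may be 0, while the hyperkernel collects exponents from 1
        on.\<close>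
      moreover have "a \<in> left_annihilator (y ^ Suc p)"
        using a(1) left_annihilator_power_mono[of p "Suc p" y] by (auto simp: p)
      then have "a \<in> hyperkernel y"
        unfolding hyperkernel_def by (intro UN_I[of "Suc p"]) simp_all
      ultimately show ?thesis
        using ascent_kernel[OF D_ascent[OF \<open>?D\<close>]] by blast
    qed
    moreover have "0 \<in> H"
      unfolding p by (rule zero_in_left_annihilator)
    moreover have "0 \<in> K"
      unfolding K_def right_analytical_core_def
      by (intro CollectI exI[of _ "\<lambda>_. 0"] exI[of _ 1]) simp
    ultimately show ?thesis by blast
  qed
  have HK_closed: "closed (H \<inter> K)" if "H \<inter> K = {0}"
    using that by simp
  show "?D \<longleftrightarrow> right_ascent y < \<infinity>"
    using D_ascent ascent_kernel kernel_N N_D by iprover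
  show "?D \<longleftrightarrow> (\<exists>p. H = left_annihilator (y ^ p))"
    using D_H H_closed closed_N(1) N_D by iprover
  show "?D \<longleftrightarrow> closed H"
    using D_H H_closed closed_N(1) N_D by iprover
  show "?D \<longleftrightarrow> H \<inter> K = {0}"
    using D_HK HK_closed closed_N(2) N_D by iprover
  show "?D \<longleftrightarrow> closed (H \<inter> K)"
    using D_HK HK_closed closed_N(2) N_D by iprover
  show "?D \<longleftrightarrow> hyperkernel y \<inter> hyperrange y = {0}"
    using D_ascent ascent_kernel kernel_N N_D by iprover
  show "?D \<longleftrightarrow> ?N"
    using D_ascent ascent_kernel kernel_N N_D by iprover
qed

lemma not_islimpt_right_spectrum:
  fixes x :: "'a::complex_unital_banach_algebra"
  assumes "left_descent (x - l *\<^sub>C 1) < \<infinity>"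
  shows "\<not> l islimpt right_spectrum x"
proof
  assume l: "l islimpt right_spectrum x"
  obtain n c where c: "(x - l *\<^sub>C 1) ^ n = (x - l *\<^sub>C 1) ^ Suc n * c"
    using assms unfolding left_descent_finite_iff by blast
  have "1 / (norm c + 1) > 0"
    by (simp add: add_nonneg_pos)
  then obtain \<mu> where \<mu>: "\<mu> \<in> right_spectrum x" "\<mu> \<noteq> l" "dist \<mu> l < 1 / (norm c + 1)"
    using l unfolding islimpt_approachable by blast
  have "cmod (\<mu> - l) * norm c \<le> 1 / (norm c + 1) * norm c"
    using \<mu> by (intro mult_right_mono) (auto simp: dist_norm)
  also have "\<dots> < 1"
    by (simp add: divide_less_eq_1 add_nonneg_pos)
  finally have "right_invertible (x - l *\<^sub>C 1 - (\<mu> - l) *\<^sub>C 1)"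
    using \<mu>(2) by (intro right_invertible_near_if_descends[OF c]) auto
  then show False
    using \<mu>(1) by (simp add: right_spectrum_def scaleC.diff_left)
qed

theorem theorem3p5:
  fixes x :: "'a::complex_unital_banach_algebra" and l0 :: complex
  assumes "semiprime TYPE('a)"
    and "(soc :: 'a set) \<noteq> {0}"
    and "B_Fredholm (x - l0 *\<^sub>C 1)"
  shows
    "(right_SVEP x l0 \<longleftrightarrow> right_ascent (x - l0 *\<^sub>C 1) < \<infinity>) \<and>
     (right_SVEP x l0 \<longleftrightarrow> left_descent (x - l0 *\<^sub>C 1) < \<infinity>) \<and>
     (right_SVEP x l0 \<longleftrightarrow> \<not> l0 islimpt right_spectrum x) \<and>
     (right_SVEP x l0 \<longleftrightarrow> l0 \<notin> interior (right_spectrum x)) \<and>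
     (right_SVEP x l0 \<longleftrightarrow>
        (\<exists>p::nat. right_quasinilpotent_part (x - l0 *\<^sub>C 1) = left_annihilator ((x - l0 *\<^sub>C 1) ^ p))) \<and>
     (right_SVEP x l0 \<longleftrightarrow> closed (right_quasinilpotent_part (x - l0 *\<^sub>C 1))) \<and>
     (right_SVEP x l0 \<longleftrightarrow>
        right_quasinilpotent_part (x - l0 *\<^sub>C 1) \<inter> right_analytical_core (x - l0 *\<^sub>C 1) = {0}) \<and>
     (right_SVEP x l0 \<longleftrightarrow>
        closed (right_quasinilpotent_part (x - l0 *\<^sub>C 1) \<inter> right_analytical_core (x - l0 *\<^sub>C 1))) \<and>
     (right_SVEP x l0 \<longleftrightarrow>
        (\<Union>n\<in>{1..}. left_annihilator ((x - l0 *\<^sub>C 1) ^ n)) \<inter>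
        (\<Inter>n\<in>{1..}. range (\<lambda>a. a * (x - l0 *\<^sub>C 1) ^ n)) = {0}) \<and>
     (right_SVEP x l0 \<longrightarrow>
        (\<exists>p. right_ascent (x - l0 *\<^sub>C 1) = enat p \<and>
             right_quasinilpotent_part (x - l0 *\<^sub>C 1) =
               (\<Union>n\<in>{1..}. left_annihilator ((x - l0 *\<^sub>C 1) ^ n)) \<and>
             (\<Union>n\<in>{1..}. left_annihilator ((x - l0 *\<^sub>C 1) ^ n)) =
               left_annihilator ((x - l0 *\<^sub>C 1) ^ p)))"
proof -
  define y where "y = x - l0 *\<^sub>C 1"
  have y: "B_Fredholm y"
    using assms(3) by (simp add: y_def)
  note descends_iff = B_Fredholm_descends_iff[OF assms(1) y]
  have SVEP: "right_SVEP x l0 \<Longrightarrow> left_descent y < \<infinity>"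
    using left_annihilator_Int_hyperrange_if_right_SVEP[OF assms(1,3)] descends_iff(7)
    unfolding y_def by blast
  have limpt: "left_descent y < \<infinity> \<Longrightarrow> \<not> l0 islimpt right_spectrum x"
    unfolding y_def by (rule not_islimpt_right_spectrum)
  have interior: "\<not> l0 islimpt right_spectrum x \<Longrightarrow> l0 \<notin> interior (right_spectrum x)"
    using interior_limit_point by blast
  \<comment> \<open>With \<open>right_SVEP_if_not_interior\<close> the three preceding implications
    close to a cycle.\<close>
  have SVEP_iff: "right_SVEP x l0 \<longleftrightarrow> left_descent y < \<infinity>"
    "right_SVEP x l0 \<longleftrightarrow> \<not> l0 islimpt right_spectrum x"
    "right_SVEP x l0 \<longleftrightarrow> l0 \<notin> interior (right_spectrum x)"
    using SVEP limpt interior right_SVEP_if_not_interior by blast+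
  have "\<exists>p. right_ascent y = enat p \<and> right_quasinilpotent_part y = hyperkernel y \<and>
      hyperkernel y = left_annihilator (y ^ p)" if "right_SVEP x l0"
  proof -
    have D: "left_descent y < \<infinity>"
      using that SVEP by blast
    then have "right_ascent y < \<infinity>"
      unfolding descends_iff(1) .
    then obtain p where p: "right_ascent y = enat p"
      "left_annihilator (y ^ p) = left_annihilator (y ^ Suc p)"
      by (rule right_ascent_finiteE)
    \<comment> \<open>This \<open>n\<close> need not be the ascent \<open>p\<close>. The inclusion
      into \<open>L(y^n)\<close> is therefore widened to the hyperkernel, which equals
      \<open>L(y^p)\<close>.\<close>
    obtain n c where "y ^ n = y ^ Suc n * c"
      using D unfolding left_descent_finite_iff by blast
    then have "right_quasinilpotent_part y \<subseteq> left_annihilator (y ^ n)"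
      by (rule quasinilpotent_part_subset_if_descends)
    also have "\<dots> \<subseteq> left_annihilator (y ^ Suc n)"
      by (rule left_annihilator_power_mono) simp
    also have "\<dots> \<subseteq> hyperkernel y"
      by (auto simp: hyperkernel_def)
    finally have "right_quasinilpotent_part y = hyperkernel y"
      using left_annihilator_subset_quasinilpotent_part[of y p] hyperkernel_eq[OF p(2)] by blast
    then show ?thesis
      using p hyperkernel_eq by blast
  qed
  then show ?thesis
    unfolding y_def[symmetric] hyperkernel_def[symmetric] hyperrange_def[symmetric]
    using SVEP_iff descends_iff(1-6) by simp
qed

end
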